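(* For every integer $n \ge 5$, the representation $V_n = \mathrm{Ind}_{C_{3,n}}^{S_{3n}}(1)$ of $S_{3n}$ is not multiplicity-free; that is, some irreducible representation $S^\lambda$ of $S_{3n}$ (with $\lambda \vdash 3n$) occurs in $V_n$ with multiplicity at least $2$.
   Context: All representations are over $\mathbb{C}$, and $1$ denotes the trivial representation. For positive integers $m,n$, $C_{m,n} \subseteq S_{mn}$ is the wreath product of $S_n$ with $S_m$ (written $S_n \text{ wr } S_m$ in the paper), of order $(m!)^n\, n!$. Concretely, $C_{m,n} \cong (S_m)^n \rtimes S_n$ is the stabilizer in $S_{mn}$ of the set partition of $\{1,\dots,mn\}$ into the $n$ blocks $\{1,\dots,m\}, \{m+1,\dots,2m\}, \dots, \{(n-1)m+1,\dots,nm\}$ of size $m$. Thus $\mathrm{Ind}_{C_{m,n}}^{S_{mn}}(1)$ is the permutation representation of $S_{mn}$ on set partitions of $\{1,\dots,mn\}$ into $n$ blocks of size $m$. $S^\lambda$ denotes the Specht module (irreducible representation) indexed by the partition $\lambda$. *)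

theory Defs
  imports Complex_Main "HOL-Algebra.Sym_Groups" "HOL-Library.Function_Algebras"
begin

section \<open>Complex representations\<close>

text \<open>
  The vector space of a representation is a subspace of an ambient complex vector space, which is
  given by the type \<open>'v\<close> together with a scalar multiplication; only the action of
  elements of the group on vectors of \<open>rep_space\<close> is meaningful.
\<close>

record ('g, 'v) rep =
  rep_space :: "'v set"
  rep_scale :: "complex \<Rightarrow> 'v \<Rightarrow> 'v"
  rep_act :: "'g \<Rightarrow> 'v \<Rightarrow> 'v"

definition representation :: "('g, 'm) monoid_scheme \<Rightarrow> ('g, 'v::ab_group_add) rep \<Rightarrow> bool"
  where "representation G V \<longleftrightarrow>
    vector_space (rep_scale V) \<and>
    module.subspace (rep_scale V) (rep_space V) \<and>
    (\<forall>g\<in>carrier G. \<forall>v\<in>rep_space V. rep_act V g v \<in> rep_space V) \<and>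
    (\<forall>g\<in>carrier G. \<forall>v\<in>rep_space V. \<forall>w\<in>rep_space V.
       rep_act V g (v + w) = rep_act V g v + rep_act V g w) \<and>
    (\<forall>g\<in>carrier G. \<forall>c. \<forall>v\<in>rep_space V.
       rep_act V g (rep_scale V c v) = rep_scale V c (rep_act V g v)) \<and>
    (\<forall>v\<in>rep_space V. rep_act V \<one>\<^bsub>G\<^esub> v = v) \<and>
    (\<forall>g\<in>carrier G. \<forall>h\<in>carrier G. \<forall>v\<in>rep_space V.
       rep_act V (g \<otimes>\<^bsub>G\<^esub> h) v = rep_act V g (rep_act V h v))"

definition isomorphic_reps ::
    "('g, 'm) monoid_scheme \<Rightarrow> ('g, 'v::ab_group_add) rep \<Rightarrow> ('g, 'w::ab_group_add) rep \<Rightarrow> bool"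
  where "isomorphic_reps G V W \<longleftrightarrow> (\<exists>f.
    bij_betw f (rep_space V) (rep_space W) \<and>
    (\<forall>v\<in>rep_space V. \<forall>w\<in>rep_space V. f (v + w) = f v + f w) \<and>
    (\<forall>c. \<forall>v\<in>rep_space V. f (rep_scale V c v) = rep_scale W c (f v)) \<and>
    (\<forall>g\<in>carrier G. \<forall>v\<in>rep_space V. f (rep_act V g v) = rep_act W g (f v)))"

definition invariant_subspace ::
    "('g, 'm) monoid_scheme \<Rightarrow> ('g, 'v::ab_group_add) rep \<Rightarrow> 'v set \<Rightarrow> bool"
  where "invariant_subspace G V W \<longleftrightarrow>
    W \<subseteq> rep_space V \<and> module.subspace (rep_scale V) W \<and>
    (\<forall>g\<in>carrier G. \<forall>w\<in>W. rep_act V g w \<in> W)"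

definition irreducible_rep :: "('g, 'm) monoid_scheme \<Rightarrow> ('g, 'v::ab_group_add) rep \<Rightarrow> bool"
  where "irreducible_rep G V \<longleftrightarrow>
    representation G V \<and> rep_space V \<noteq> {0} \<and>
    (\<forall>W. invariant_subspace G V W \<longrightarrow> W = {0} \<or> W = rep_space V)"

text \<open>\<open>V\<close> is the internal direct sum of the irreducible subrepresentations listed in \<open>Ws\<close>.\<close>

definition irreducible_decomposition ::
    "('g, 'm) monoid_scheme \<Rightarrow> ('g, 'v::ab_group_add) rep \<Rightarrow> 'v set list \<Rightarrow> bool"
  where "irreducible_decomposition G V Ws \<longleftrightarrow>
    (\<forall>W\<in>set Ws. invariant_subspace G V W \<and> irreducible_rep G (V\<lparr>rep_space := W\<rparr>)) \<and>
    (\<forall>v\<in>rep_space V. \<exists>!ws. list_all2 (\<in>) ws Ws \<and> sum_list ws = v)"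

text \<open>
  The number of summands isomorphic to \<open>S\<close> in a decomposition of \<open>V\<close> into irreducibles. A
  finite-dimensional representation of a finite group has such a decomposition, and by the
  Krull-Schmidt theorem the number does not depend on the one that is chosen.
\<close>

definition rep_multiplicity ::
    "('g, 'm) monoid_scheme \<Rightarrow> ('g, 'w::ab_group_add) rep \<Rightarrow> ('g, 'v::ab_group_add) rep \<Rightarrow> nat"
  where "rep_multiplicity G S V =
    length (filter (\<lambda>W. isomorphic_reps G S (V\<lparr>rep_space := W\<rparr>))
      (SOME Ws. irreducible_decomposition G V Ws))"

text \<open>
  An irreducible representation that occurs in \<open>V\<close> at all is isomorphic to a subrepresentation of
  \<open>V\<close>, so it suffices to quantify over these.
\<close>

definition multiplicity_free ::
    "('g, 'm) monoid_scheme \<Rightarrow> ('g, 'v::ab_group_add) rep \<Rightarrow> bool"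
  where "multiplicity_free G V \<longleftrightarrow>
    (\<forall>W. invariant_subspace G V W \<and> irreducible_rep G (V\<lparr>rep_space := W\<rparr>) \<longrightarrow>
       rep_multiplicity G (V\<lparr>rep_space := W\<rparr>) V \<le> 1)"

definition trivial_rep :: "('g, complex) rep"
  where "trivial_rep = \<lparr>rep_space = UNIV, rep_scale = (*), rep_act = (\<lambda>_ v. v)\<rparr>"

text \<open>
  The function model of the representation induced from a subgroup \<open>H\<close> of \<open>G\<close>: the functions
  \<open>f : G \<rightarrow> V\<close> with \<open>f (h x) = h (f x)\<close>, on which \<open>G\<close> acts by right translation. For a finite
  group this is the usual induced representation. The functions vanish outside the carrier of \<open>G\<close>.
\<close>

definition induced_rep ::
    "('g, 'm) monoid_scheme \<Rightarrow> 'g set \<Rightarrow> ('g, 'v::ab_group_add) rep \<Rightarrow> ('g, 'g \<Rightarrow> 'v) rep"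
  where "induced_rep G H V =
    \<lparr>rep_space = {f. (\<forall>x\<in>carrier G. f x \<in> rep_space V) \<and> (\<forall>x. x \<notin> carrier G \<longrightarrow> f x = 0) \<and>
        (\<forall>h\<in>H. \<forall>x\<in>carrier G. f (h \<otimes>\<^bsub>G\<^esub> x) = rep_act V h (f x))},
     rep_scale = (\<lambda>c f x. rep_scale V c (f x)),
     rep_act = (\<lambda>g f x. if x \<in> carrier G then f (x \<otimes>\<^bsub>G\<^esub> g) else 0)\<rparr>"


section \<open>The wreath product\<close>

definition blocks :: "nat \<Rightarrow> nat \<Rightarrow> nat set set"
  where "blocks m n = (\<lambda>i. {i * m + 1..(i + 1) * m}) ` {..<n}"

definition wreath :: "nat \<Rightarrow> nat \<Rightarrow> (nat \<Rightarrow> nat) set"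
  where "wreath m n = {p \<in> carrier (sym_group (m * n)). (\<lambda>B. p ` B) ` blocks m n = blocks m n}"


section \<open>Specht modules\<close>

text \<open>A partition is the list of its parts; rows and columns of Young diagrams start at 0.\<close>

definition partition_of :: "nat \<Rightarrow> nat list \<Rightarrow> bool"
  where "partition_of N la \<longleftrightarrow> sorted_wrt (\<ge>) la \<and> 0 \<notin> set la \<and> sum_list la = N"

definition cells :: "nat list \<Rightarrow> (nat \<times> nat) set"
  where "cells la = {(i, j). i < length la \<and> j < la ! i}"

definition tableau :: "nat list \<Rightarrow> (nat \<times> nat \<Rightarrow> nat) \<Rightarrow> bool"
  where "tableau la t \<longleftrightarrow> bij_betw t (cells la) {1..sum_list la}"

text \<open>
  Two tableaux of the same shape are row equivalent iff their rows have the same sets of entries,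
  so a tabloid (row equivalence class) is encoded as the list of these sets.
\<close>

definition tabloid :: "nat list \<Rightarrow> (nat \<times> nat \<Rightarrow> nat) \<Rightarrow> nat set list"
  where "tabloid la t = map (\<lambda>i. {t (i, j) |j. (i, j) \<in> cells la}) [0..<length la]"

definition perm_tabloid :: "(nat \<Rightarrow> nat) \<Rightarrow> nat set list \<Rightarrow> nat set list"
  where "perm_tabloid p T = map (\<lambda>R. p ` R) T"

text \<open>
  The permutation module on tabloids: an element \<open>f\<close> stands for the formal sum of the
  \<open>f T\<close> multiples of the tabloids \<open>T\<close>, hence the inverse in the action.
\<close>

definition tabloid_module :: "nat list \<Rightarrow> (nat \<Rightarrow> nat, nat set list \<Rightarrow> complex) rep"
  where "tabloid_module la =
    \<lparr>rep_space = {f. \<forall>T. f T \<noteq> 0 \<longrightarrow> (\<exists>t. tableau la t \<and> T = tabloid la t)},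
     rep_scale = (\<lambda>c f T. c * f T),
     rep_act = (\<lambda>p f T. f (perm_tabloid (inv' p) T))\<rparr>"

definition column_stabilizer :: "nat list \<Rightarrow> (nat \<times> nat \<Rightarrow> nat) \<Rightarrow> (nat \<Rightarrow> nat) set"
  where "column_stabilizer la t = {p \<in> carrier (sym_group (sum_list la)).
    \<forall>j. p ` {t (i, j) |i. (i, j) \<in> cells la} = {t (i, j) |i. (i, j) \<in> cells la}}"

definition polytabloid :: "nat list \<Rightarrow> (nat \<times> nat \<Rightarrow> nat) \<Rightarrow> nat set list \<Rightarrow> complex"
  where "polytabloid la t = (\<lambda>T. \<Sum>p\<in>column_stabilizer la t.
    of_int (sign p) * (if T = perm_tabloid p (tabloid la t) then 1 else 0))"

definition specht :: "nat list \<Rightarrow> (nat \<Rightarrow> nat, nat set list \<Rightarrow> complex) rep"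
  where "specht la = (tabloid_module la)\<lparr>rep_space :=
    module.span (rep_scale (tabloid_module la)) {polytabloid la t |t. tableau la t}\<rparr>"

end

theory Submission
  imports Defs
begin

text \<open>
  The partition \<open>\<lambda> = (3n - 6, 4, 2)\<close> has multiplicity at least 2. For \<open>n = 5\<close> it is \<open>(9, 4, 2)\<close>.

  By Frobenius reciprocity, a homomorphism from the Specht module to \<open>V\<close> is a linear functional on
  the Specht module that is invariant under the wreath product. A tabloid of shape \<open>\<lambda>\<close> distributes the
  elements of each block over the three rows; the product over all blocks of a number that depends
  only on this distribution is invariant (\<open>block_weight_wreath\<close>). Normalize the number to 1 for blocks
  that lie in the first row. A polytabloid only involves permutations of the first four columns, so for
  a tableau with these columns among the elements of the first five blocks, the value of the functional
  is a sum of \<open>3! 3! 2! 2! = 144\<close> signed terms that does not depend on \<open>n\<close> (\<open>signed_sum_block_weight\<close>).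
  Two functionals and two polytabloids with a nonsingular matrix of values
  (\<open>alternating_weight_values\<close>) thus yield two linearly independent homomorphisms for all \<open>n \<ge> 5\<close> at once.

  Two independent homomorphisms amount to multiplicity at least 2 by Schur's lemma
  (\<open>two_homs_imp_multiplicity_ge_2\<close>), given three facts. Decompositions into irreducibles exist, by
  taking orthogonal complements (\<open>maschke\<close>). The Specht module is irreducible
  (\<open>irreducible_specht\<close>), and its endomorphisms are scalars (\<open>specht_endomorphism_scalar\<close>); both follow
  from James's observation that a vector on which the column stabilizer of a tableau acts by the sign
  character is a multiple of the polytabloid (\<open>alternating_eq_multiple_polytabloid\<close>).
\<close>


section \<open>Homomorphisms and multiplicities\<close>

definition rep_hom ::
    "('g, 'm) monoid_scheme \<Rightarrow> ('g, 'v::ab_group_add) rep \<Rightarrow> ('g, 'w::ab_group_add) rep \<Rightarrow> ('v \<Rightarrow> 'w) \<Rightarrow> bool"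
  where "rep_hom G V W f \<longleftrightarrow>
    (\<forall>v\<in>rep_space V. f v \<in> rep_space W) \<and>
    (\<forall>v\<in>rep_space V. \<forall>w\<in>rep_space V. f (v + w) = f v + f w) \<and>
    (\<forall>c. \<forall>v\<in>rep_space V. f (rep_scale V c v) = rep_scale W c (f v)) \<and>
    (\<forall>g\<in>carrier G. \<forall>v\<in>rep_space V. f (rep_act V g v) = rep_act W g (f v))"

lemma isomorphic_reps_iff_bij_hom:
  "isomorphic_reps G V W \<longleftrightarrow> (\<exists>f. rep_hom G V W f \<and> bij_betw f (rep_space V) (rep_space W))"
  unfolding isomorphic_reps_def rep_hom_def
proof (intro iff_exI)
  fix f
  have "bij_betw f (rep_space V) (rep_space W) \<Longrightarrow> \<forall>v\<in>rep_space V. f v \<in> rep_space W"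
    by (rule bij_betwE)
  then show "(bij_betw f (rep_space V) (rep_space W) \<and>
      (\<forall>v\<in>rep_space V. \<forall>w\<in>rep_space V. f (v + w) = f v + f w) \<and>
      (\<forall>c. \<forall>v\<in>rep_space V. f (rep_scale V c v) = rep_scale W c (f v)) \<and>
      (\<forall>g\<in>carrier G. \<forall>v\<in>rep_space V. f (rep_act V g v) = rep_act W g (f v))) =
    (((\<forall>v\<in>rep_space V. f v \<in> rep_space W) \<and>
      (\<forall>v\<in>rep_space V. \<forall>w\<in>rep_space V. f (v + w) = f v + f w) \<and>
      (\<forall>c. \<forall>v\<in>rep_space V. f (rep_scale V c v) = rep_scale W c (f v)) \<and>
      (\<forall>g\<in>carrier G. \<forall>v\<in>rep_space V. f (rep_act V g v) = rep_act W g (f v))) \<and>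
     bij_betw f (rep_space V) (rep_space W))" by argo
qed

lemma subspace_iff:
  assumes "vector_space s"
  shows "module.subspace s W \<longleftrightarrow>
    0 \<in> W \<and> (\<forall>x\<in>W. \<forall>y\<in>W. x + y \<in> W) \<and> (\<forall>c. \<forall>x\<in>W. s c x \<in> W)"
  using assms module.subspace_def[of s W] by (simp add: module_iff_vector_space)

lemma rep_space_closed:
  assumes "representation G V"
  shows "0 \<in> rep_space V"
    and "v \<in> rep_space V \<Longrightarrow> w \<in> rep_space V \<Longrightarrow> v + w \<in> rep_space V"
    and "v \<in> rep_space V \<Longrightarrow> rep_scale V c v \<in> rep_space V"
    and "g \<in> carrier G \<Longrightarrow> v \<in> rep_space V \<Longrightarrow> rep_act V g v \<in> rep_space V"
  using assms unfolding representation_def by (auto simp: subspace_iff)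

lemma rep_scale_zero:
  assumes "representation G V" shows "rep_scale V c 0 = 0"
proof -
  interpret vector_space "rep_scale V" using assms by (simp add: representation_def)
  show "rep_scale V c 0 = 0" by simp
qed

lemma rep_act_zero:
  assumes "representation G V" "g \<in> carrier G" shows "rep_act V g 0 = 0"
proof -
  have "rep_act V g (0 + 0) = rep_act V g 0 + rep_act V g 0"
    using assms rep_space_closed(1)[OF assms(1)] unfolding representation_def by blast
  then show ?thesis by simp
qed

lemma rep_act_add:
  assumes "representation G V" "g \<in> carrier G" "v \<in> rep_space V" "w \<in> rep_space V"
  shows "rep_act V g (v + w) = rep_act V g v + rep_act V g w"
  using assms unfolding representation_def by blast

lemma rep_act_mult:
  assumes "representation G V" "g \<in> carrier G" "h \<in> carrier G" "v \<in> rep_space V"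
  shows "rep_act V (g \<otimes>\<^bsub>G\<^esub> h) v = rep_act V g (rep_act V h v)"
  using assms unfolding representation_def by blast

lemma invariant_subspaceD:
  assumes "representation G V" "invariant_subspace G V W"
  shows "W \<subseteq> rep_space V" "0 \<in> W"
    "x \<in> W \<Longrightarrow> y \<in> W \<Longrightarrow> x + y \<in> W" "x \<in> W \<Longrightarrow> rep_scale V c x \<in> W"
    "g \<in> carrier G \<Longrightarrow> x \<in> W \<Longrightarrow> rep_act V g x \<in> W"
  using assms unfolding invariant_subspace_def representation_def by (auto simp: subspace_iff)

lemma invariant_subspaceI:
  assumes "representation G V" "W \<subseteq> rep_space V" "0 \<in> W"
    "\<And>x y. x \<in> W \<Longrightarrow> y \<in> W \<Longrightarrow> x + y \<in> W" "\<And>c x. x \<in> W \<Longrightarrow> rep_scale V c x \<in> W"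
    "\<And>g x. g \<in> carrier G \<Longrightarrow> x \<in> W \<Longrightarrow> rep_act V g x \<in> W"
  shows "invariant_subspace G V W"
  using assms unfolding invariant_subspace_def representation_def by (auto simp: subspace_iff)

lemma subrepresentation:
  assumes "representation G V" "invariant_subspace G V W"
  shows "representation G (V\<lparr>rep_space := W\<rparr>)"
  using assms unfolding representation_def invariant_subspace_def by (simp add: subset_iff)

lemma invariant_subspace_subrep:
  assumes "W \<subseteq> rep_space V"
  shows "invariant_subspace G (V\<lparr>rep_space := W\<rparr>) U \<longleftrightarrow> invariant_subspace G V U \<and> U \<subseteq> W"
  using assms unfolding invariant_subspace_def by auto

lemma rep_hom_zero:
  assumes "representation G V" "rep_hom G V W f" shows "f 0 = 0"
proof -
  have "f (0 + 0) = f 0 + f 0"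
    using assms(2) rep_space_closed(1)[OF assms(1)] unfolding rep_hom_def by blast
  then show ?thesis by simp
qed

lemma rep_hom_comp:
  assumes "rep_hom G U V f" "rep_hom G V W g" shows "rep_hom G U W (g \<circ> f)"
  using assms unfolding rep_hom_def by simp

lemma rep_hom_inverse:
  assumes V: "representation G V" and f: "rep_hom G V W f" and bij: "bij_betw f (rep_space V) (rep_space W)"
  shows "rep_hom G W V (inv_into (rep_space V) f)"
proof -
  let ?g = "inv_into (rep_space V) f"
  have g: "?g w \<in> rep_space V" "f (?g w) = w" if "w \<in> rep_space W" for w
    using that bij by (auto simp: bij_betw_def inv_into_into f_inv_into_f)
  have gf: "?g (f v) = v" if "v \<in> rep_space V" for v
    using that bij by (simp add: bij_betw_def)
  note cl = rep_space_closed[OF V]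
  show ?thesis unfolding rep_hom_def
  proof (intro conjI ballI allI)
    fix v w assume "v \<in> rep_space W" "w \<in> rep_space W"
    then have "f (?g v + ?g w) = v + w" using f g unfolding rep_hom_def by simp
    then show "?g (v + w) = ?g v + ?g w"
      using gf[of "?g v + ?g w"] cl g \<open>v \<in> rep_space W\<close> \<open>w \<in> rep_space W\<close> by metis
  next
    fix c v assume v: "v \<in> rep_space W"
    then have "f (rep_scale V c (?g v)) = rep_scale W c v" using f g unfolding rep_hom_def by simp
    then show "?g (rep_scale W c v) = rep_scale V c (?g v)" using gf cl g v by metis
  next
    fix h v assume h: "h \<in> carrier G" and v: "v \<in> rep_space W"
    then have "f (rep_act V h (?g v)) = rep_act W h v" using f g unfolding rep_hom_def by simp
    then show "?g (rep_act W h v) = rep_act V h (?g v)" using gf cl g v h by metis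
  qed (use g in auto)
qed

lemma isomorphic_reps_sym:
  "representation G V \<Longrightarrow> isomorphic_reps G V W \<Longrightarrow> isomorphic_reps G W V"
  unfolding isomorphic_reps_iff_bij_hom by (meson rep_hom_inverse bij_betw_inv_into)

lemma isomorphic_reps_trans:
  "isomorphic_reps G U V \<Longrightarrow> isomorphic_reps G V W \<Longrightarrow> isomorphic_reps G U W"
  unfolding isomorphic_reps_iff_bij_hom by (meson rep_hom_comp bij_betw_trans)

text \<open>
  Whatever decomposition the multiplicity is read off from, isomorphic representations select the
  same summands of it. This carries a multiplicity from a Specht module to a subrepresentation.
\<close>

lemma rep_multiplicity_cong:
  assumes S: "representation G S" and S': "representation G S'" and iso: "isomorphic_reps G S S'"
  shows "rep_multiplicity G S V = rep_multiplicity G S' V"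
proof -
  have "isomorphic_reps G S (V\<lparr>rep_space := W\<rparr>) = isomorphic_reps G S' (V\<lparr>rep_space := W\<rparr>)" for W
    using isomorphic_reps_trans[OF iso] isomorphic_reps_trans[OF isomorphic_reps_sym[OF S iso]]
    by (rule iffI[rotated])
  then show ?thesis by (simp add: rep_multiplicity_def)
qed

text \<open>
  Schur's lemma: the kernel and the image of a homomorphism are invariant, so irreducibility of the
  source makes a nonzero homomorphism injective and irreducibility of the target makes it surjective.
\<close>

lemma schur:
  assumes S: "irreducible_rep G S" and W: "irreducible_rep G W" and f: "rep_hom G S W f"
    and nz: "v \<in> rep_space S" "f v \<noteq> 0"
  shows "bij_betw f (rep_space S) (rep_space W)"
proof -
  have rS: "representation G S" and rW: "representation G W"
    using S W by (auto simp: irreducible_rep_def)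
  note cS = rep_space_closed[OF rS] note cW = rep_space_closed[OF rW]
  let ?K = "{v \<in> rep_space S. f v = 0}"
  have "invariant_subspace G S ?K"
    by (rule invariant_subspaceI[OF rS])
      (use cS f rep_hom_zero[OF rS f] rep_scale_zero[OF rW] rep_act_zero[OF rW] in \<open>auto simp: rep_hom_def\<close>)
  then have K: "?K = {0}" using S nz unfolding irreducible_rep_def by blast
  have img: "f ` rep_space S \<subseteq> rep_space W" using f by (auto simp: rep_hom_def)
  have "invariant_subspace G W (f ` rep_space S)"
  proof (rule invariant_subspaceI[OF rW img])
    show "0 \<in> f ` rep_space S" using rep_hom_zero[OF rS f] cS(1) by (metis imageI)
    fix x y assume "x \<in> f ` rep_space S" "y \<in> f ` rep_space S"
    then show "x + y \<in> f ` rep_space S" using cS(2) f unfolding rep_hom_def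
      by (smt (verit) image_iff)
  next
    fix c x assume "x \<in> f ` rep_space S"
    then show "rep_scale W c x \<in> f ` rep_space S" using cS(3) f unfolding rep_hom_def
      by (smt (verit) image_iff)
  next
    fix g x assume "g \<in> carrier G" "x \<in> f ` rep_space S"
    then show "rep_act W g x \<in> f ` rep_space S" using cS(4) f unfolding rep_hom_def
      by (smt (verit) image_iff)
  qed
  then have "f ` rep_space S = {0} \<or> f ` rep_space S = rep_space W"
    using W by (auto simp: irreducible_rep_def)
  then have "f ` rep_space S = rep_space W" using nz by blast
  moreover have "inj_on f (rep_space S)"
  proof (rule inj_onI)
    fix x y assume x: "x \<in> rep_space S" and y: "y \<in> rep_space S" and e: "f x = f y"
    interpret s: vector_space "rep_scale S" using rS by (simp add: representation_def)
    interpret w: vector_space "rep_scale W" using rW by (simp add: representation_def)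
    have "f (x + rep_scale S (-1) y) = f x + rep_scale W (-1) (f y)"
      using f x y cS unfolding rep_hom_def by metis
    also have "\<dots> = 0" using e by simp
    finally have "f (x + rep_scale S (-1) y) = 0" .
    moreover have "x + rep_scale S (-1) y \<in> rep_space S" using x y cS(2,3) by blast
    ultimately have "x + rep_scale S (-1) y \<in> ?K" by blast
    then have "x + rep_scale S (-1) y = 0" using K by blast
    then show "x = y" by simp
  qed
  ultimately show ?thesis by (simp add: bij_betw_def)
qed

lemma decomposition_unique:
  assumes "irreducible_decomposition G V Ws"
    and "\<forall>i<length Ws. u i \<in> Ws ! i" "\<forall>i<length Ws. u' i \<in> Ws ! i"
    and "(\<Sum>i<length Ws. u i) \<in> rep_space V" "(\<Sum>i<length Ws. u i) = (\<Sum>i<length Ws. u' i)"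
    and "i < length Ws"
  shows "u i = u' i"
proof -
  have "list_all2 (\<in>) (map u [0..<length Ws]) Ws \<and> sum_list (map u [0..<length Ws]) = (\<Sum>i<length Ws. u i)"
    if "\<forall>i<length Ws. u i \<in> Ws ! i" for u
    using that by (simp add: list_all2_conv_all_nth interv_sum_list_conv_sum_set_nat atLeast0LessThan)
  from this[OF assms(2)] this[OF assms(3)]
  have "map u [0..<length Ws] = map u' [0..<length Ws]"
    using assms(1,4,5) unfolding irreducible_decomposition_def by metis
  then show ?thesis using assms(6) by simp
qed

text \<open>
  Uniqueness of the components of a vector is what makes the component maps additive, homogeneous and
  equivariant: the images of the components are again a choice of components, for the image vector.
\<close>

lemma decomposition_projections:
  assumes V: "representation G V" and D: "irreducible_decomposition G V Ws"
  obtains pr where "\<And>i. i < length Ws \<Longrightarrow> rep_hom G V (V\<lparr>rep_space := Ws ! i\<rparr>) (pr i)"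
    and "\<And>v. v \<in> rep_space V \<Longrightarrow> (\<Sum>i<length Ws. pr i v) = v"
proof -
  let ?n = "length Ws"
  have ex: "\<exists>u. (\<forall>i<?n. u i \<in> Ws ! i) \<and> (\<Sum>i<?n. u i) = v" if v: "v \<in> rep_space V" for v
  proof -
    obtain ws where ws: "list_all2 (\<in>) ws Ws" "sum_list ws = v"
      using D v unfolding irreducible_decomposition_def by (metis (no_types))
    have "length ws = length Ws" using ws(1) by (rule list_all2_lengthD)
    then show ?thesis using ws
      by (intro exI[of _ "\<lambda>i. ws ! i"])
        (simp add: list_all2_conv_all_nth sum_list_sum_nth atLeast0LessThan)
  qed
  define u where "u v = (SOME u. (\<forall>i<?n. u i \<in> Ws ! i) \<and> (\<Sum>i<?n. u i) = v)" for v
  have u: "\<forall>i<?n. u v i \<in> Ws ! i" "(\<Sum>i<?n. u v i) = v" if "v \<in> rep_space V" for v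
    using someI_ex[OF ex[OF that]] unfolding u_def by auto
  have inv: "invariant_subspace G V (Ws ! i)" if "i < ?n" for i
    using D that unfolding irreducible_decomposition_def by simp
  note W = invariant_subspaceD[OF V inv]
  note cl = rep_space_closed[OF V]
  have uniq: "u v i = u' i" if "v \<in> rep_space V" "\<forall>i<?n. u' i \<in> Ws ! i" "(\<Sum>i<?n. u' i) = v" "i < ?n"
    for v u' i
    using decomposition_unique[OF D u(1)[OF that(1)] that(2) _ _ that(4)] u(2)[OF that(1)] that by simp
  interpret vector_space "rep_scale V" using V by (simp add: representation_def)
  have act_sum: "rep_act V g (\<Sum>i<k. w i) = (\<Sum>i<k. rep_act V g (w i)) \<and> (\<Sum>i<k. w i) \<in> rep_space V"
    if "g \<in> carrier G" "\<And>i. i < k \<Longrightarrow> w i \<in> rep_space V" for g w and k :: nat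
    using that(2)
  proof (induction k)
    case 0 then show ?case using rep_act_zero[OF V that(1)] cl(1) by simp
  next
    case (Suc k)
    then show ?case using rep_act_add[OF V that(1)] cl(2) by simp
  qed
  have "rep_hom G V (V\<lparr>rep_space := Ws ! i\<rparr>) (\<lambda>v. u v i)" if i: "i < ?n" for i
    unfolding rep_hom_def
  proof (intro conjI ballI allI)
    fix v w assume "v \<in> rep_space V" "w \<in> rep_space V"
    then show "u (v + w) i = u v i + u w i"
      using uniq[of "v + w" "\<lambda>i. u v i + u w i" i] u W cl i by (simp add: sum.distrib)
  next
    fix c v assume "v \<in> rep_space V"
    then show "u (rep_scale V c v) i = rep_scale (V\<lparr>rep_space := Ws ! i\<rparr>) c (u v i)"
      using uniq[of "rep_scale V c v" "\<lambda>i. rep_scale V c (u v i)" i] u W cl i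
      by (simp add: scale_sum_right[symmetric])
  next
    fix g v assume g: "g \<in> carrier G" and v: "v \<in> rep_space V"
    have "(\<Sum>i<?n. rep_act V g (u v i)) = rep_act V g v"
      using act_sum[OF g, of ?n "u v"] u[OF v] W(1) by (metis subsetD)
    then show "u (rep_act V g v) i = rep_act (V\<lparr>rep_space := Ws ! i\<rparr>) g (u v i)"
      using uniq[of "rep_act V g v" "\<lambda>i. rep_act V g (u v i)" i] u[OF v] W(5)[OF _ g] cl(4)[OF g v] i
      by simp
  qed (use u i in simp)
  then show thesis using that[of "\<lambda>i v. u v i"] u by blast
qed

text \<open>
  The form of Krull-Schmidt that is needed here, valid for every decomposition \<open>Ws\<close>. By Schur's lemma
  a homomorphism from \<open>S\<close> to \<open>V\<close> has nonzero components only in the summands isomorphic to \<open>S\<close>. With a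
  single such summand, \<open>f\<close> would be an isomorphism onto it and \<open>f\<^sup>-\<^sup>1 g\<close> an endomorphism of \<open>S\<close>, so
  that \<open>g\<close> would be a scalar multiple of \<open>f\<close>.
\<close>

lemma two_homs_imp_multiplicity_ge_2:
  assumes V: "representation G V" and D: "irreducible_decomposition G V Ws"
    and S: "irreducible_rep G S"
    and scalar: "\<And>f. rep_hom G S S f \<Longrightarrow> \<exists>c. \<forall>v\<in>rep_space S. f v = rep_scale S c v"
    and f: "rep_hom G S V f" and g: "rep_hom G S V g"
    and f_nz: "\<exists>v\<in>rep_space S. f v \<noteq> 0"
    and indep: "\<And>c. \<exists>v\<in>rep_space S. g v \<noteq> rep_scale V c (f v)"
  shows "length (filter (\<lambda>W. isomorphic_reps G S (V\<lparr>rep_space := W\<rparr>)) Ws) \<ge> 2"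
proof (rule ccontr)
  let ?n = "length Ws"
  let ?R = "\<lambda>i. V\<lparr>rep_space := Ws ! i\<rparr>"
  let ?I = "{i. i < ?n \<and> isomorphic_reps G S (?R i)}"
  obtain pr where pr: "\<And>i. i < ?n \<Longrightarrow> rep_hom G V (?R i) (pr i)"
    and pr_sum: "\<And>v. v \<in> rep_space V \<Longrightarrow> (\<Sum>i<?n. pr i v) = v"
    using decomposition_projections[OF V D] by blast
  have rS: "representation G S" using S by (simp add: irreducible_rep_def)
  have Wi: "irreducible_rep G (?R i)" if "i < ?n" for i
    using D that by (simp add: irreducible_decomposition_def)
  have zero: "pr i (h v) = 0" if "rep_hom G S V h" "i < ?n" "i \<notin> ?I" "v \<in> rep_space S" for h i v
  proof (rule ccontr)
    assume "pr i (h v) \<noteq> 0"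
    then have "bij_betw (pr i \<circ> h) (rep_space S) (rep_space (?R i))"
      using schur[OF S Wi[OF that(2)] rep_hom_comp[OF that(1) pr[OF that(2)]]] that by simp
    then show False using that rep_hom_comp[OF that(1) pr[OF that(2)]]
      unfolding isomorphic_reps_iff_bij_hom by blast
  qed
  assume "\<not> 2 \<le> length (filter (\<lambda>W. isomorphic_reps G S (V\<lparr>rep_space := W\<rparr>)) Ws)"
  then have "card ?I \<le> Suc 0" by (simp add: length_filter_conv_card)
  then have I1: "\<forall>i\<in>?I. \<forall>j\<in>?I. i = j" by (simp add: card_le_Suc0_iff_eq)
  have inV: "h v \<in> rep_space V" if "rep_hom G S V h" "v \<in> rep_space S" for h v
    using that by (simp add: rep_hom_def)
  obtain k where k: "k \<in> ?I"
  proof (rule ccontr)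
    assume "\<not> thesis"
    then have "?I = {}" using that by blast
    then have "f v = 0" if "v \<in> rep_space S" for v
      using pr_sum[OF inV[OF f that]] zero[OF f _ _ that] by (metis (no_types, lifting) empty_iff lessThan_iff sum.neutral)
    then show False using f_nz by blast
  qed
  have prk: "pr k (h v) = h v" if h: "rep_hom G S V h" and v: "v \<in> rep_space S" for h v
  proof -
    have "h v = (\<Sum>i<?n. pr i (h v))" using pr_sum[OF inV[OF h v]] by simp
    also have "\<dots> = (\<Sum>i\<in>{k}. pr i (h v))"
      by (rule sum.mono_neutral_right) (use k I1 zero[OF h _ _ v] in auto)
    finally show ?thesis by simp
  qed
  have hom: "rep_hom G S (?R k) h" if h: "rep_hom G S V h" for h
  proof -
    have "rep_hom G S (?R k) (pr k \<circ> h)" using rep_hom_comp[OF h pr] k by simp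
    then show ?thesis using prk[OF h] rep_space_closed[OF rS] unfolding rep_hom_def by simp
  qed
  have bij: "bij_betw f (rep_space S) (rep_space (?R k))"
    using f_nz schur[OF S Wi hom[OF f]] k by blast
  have "rep_hom G S S (inv_into (rep_space S) f \<circ> g)"
    by (rule rep_hom_comp[OF hom[OF g] rep_hom_inverse[OF rS hom[OF f] bij]])
  then obtain c where c: "\<forall>v\<in>rep_space S. inv_into (rep_space S) f (g v) = rep_scale S c v"
    using scalar by fastforce
  have "g v = rep_scale V c (f v)" if v: "v \<in> rep_space S" for v
  proof -
    have "g v \<in> f ` rep_space S" using hom[OF g] v bij by (auto simp: bij_betw_def rep_hom_def)
    then have "g v = f (rep_scale S c v)" using c v by (metis f_inv_into_f)
    then show ?thesis using f v by (simp add: rep_hom_def)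
  qed
  then show False using indep by blast
qed


section \<open>Complete reducibility of unitary function representations\<close>

lemma vector_space_fun: "vector_space (\<lambda>(c::complex) f x. c * f x :: complex)"
  by unfold_locales (auto simp: fun_eq_iff algebra_simps)

lemma sum_apply: "(\<Sum>i\<in>I. F i) y = (\<Sum>i\<in>I. F i y :: complex)" for F :: "'i \<Rightarrow> 'a \<Rightarrow> complex"
  by (induction I rule: infinite_finite_induct) auto

text \<open>
  Representations on functions that vanish outside a finite set \<open>X\<close> and whose standard Hermitian form
  is invariant. The representation induced from the trivial one is of this kind, because the group
  permutes the points on which the functions live.
\<close>

locale unitary_function_rep =
  fixes G :: "('g, 'm) monoid_scheme" and V :: "('g, 'x \<Rightarrow> complex) rep" and X :: "'x set"
  assumes group: "group G" and rep: "representation G V"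
    and scale: "rep_scale V = (\<lambda>c f x. c * f x)"
    and fin: "finite X" and supp: "f \<in> rep_space V \<Longrightarrow> x \<notin> X \<Longrightarrow> f x = 0"
    and unitary: "g \<in> carrier G \<Longrightarrow> f \<in> rep_space V \<Longrightarrow> f' \<in> rep_space V \<Longrightarrow>
      (\<Sum>x\<in>X. rep_act V g f x * cnj (rep_act V g f' x)) = (\<Sum>x\<in>X. f x * cnj (f' x))"
begin

abbreviation "fscale \<equiv> (\<lambda>(c::complex) (f :: 'x \<Rightarrow> complex) x. c * f x)"

sublocale vector_space fscale by (rule vector_space_fun)

definition ip where "ip f f' = (\<Sum>x\<in>X. f x * cnj (f' x))"

lemma ip_linear:
  "ip (f + g) h = ip f h + ip g h" "ip (fscale c f) h = c * ip f h" "ip 0 h = 0"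
  "ip (f - g) h = ip f h - ip g h"
  "ip h (f + g) = ip h f + ip h g" "ip h (fscale c f) = cnj c * ip h f" "ip h 0 = 0"
  by (simp_all add: ip_def sum_distrib_left algebra_simps sum.distrib sum_subtractf)

lemma ip_self_eq_0:
  assumes "ip f f = 0" "\<And>x. x \<notin> X \<Longrightarrow> f x = 0" shows "f = 0"
proof
  fix x
  have "ip f f = of_real (\<Sum>x\<in>X. (cmod (f x))\<^sup>2)"
    by (simp add: ip_def complex_norm_square del: of_real_power)
  then have "complex_of_real (\<Sum>x\<in>X. (cmod (f x))\<^sup>2) = 0" using assms(1) by metis
  then have "(\<Sum>x\<in>X. (cmod (f x))\<^sup>2) = 0" by (simp only: of_real_eq_0_iff)
  then have "\<forall>x\<in>X. f x = 0" using fin by (simp add: sum_nonneg_eq_0_iff)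
  then show "f x = 0 x" using assms(2) by (cases "x \<in> X") auto
qed

text \<open>
  The Gram-Schmidt process, one vector \<open>b\<close> at a time: \<open>b'\<close> is \<open>b\<close> made orthogonal to the span of \<open>B\<close>,
  and subtracting a multiple of \<open>b'\<close> from \<open>v - uv\<close> does not disturb the orthogonality to \<open>B\<close>.
\<close>

lemma orthogonal_projection:
  assumes "finite B"
  shows "\<exists>u\<in>span B. \<forall>b\<in>B. ip (v - u) b = 0"
  using assms
proof (induction B arbitrary: v)
  case empty then show ?case by (auto simp: span_zero)
next
  case (insert b B)
  have mono: "span B \<subseteq> span (insert b B)" by (rule span_mono) auto
  have b: "b \<in> span (insert b B)" by (rule span_base) simp
  obtain ub where ub: "ub \<in> span B" "\<forall>a\<in>B. ip (b - ub) a = 0" using insert.IH by blast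
  obtain uv where uv: "uv \<in> span B" "\<forall>a\<in>B. ip (v - uv) a = 0" using insert.IH by blast
  define b' where "b' = b - ub"
  have b': "b' \<in> span (insert b B)" using b ub(1) mono unfolding b'_def by (blast intro: span_diff)
  have orth: "ip z u = 0" if "u \<in> span B" "\<forall>a\<in>B. ip z a = 0" for z u
    using that(1)
  proof (rule span_induct_alt)
    fix c x y assume "x \<in> B" "ip z y = 0"
    then show "ip z (fscale c x + y) = 0" using that(2) ip_linear by metis
  qed (rule ip_linear)
  \<comment> \<open>If \<open>b'\<close> vanishes on \<open>X\<close>, the divisor is 0 and \<open>c = 0\<close>; nothing has to be corrected then.\<close>
  define c where "c = ip (v - uv) b' / ip b' b'"
  have "ip (v - uv - fscale c b') b' = 0"
  proof (cases "ip b' b' = 0")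
    case False
    have "ip (v - uv - fscale c b') b' = ip (v - uv) b' - c * ip b' b'" by (simp only: ip_linear)
    then show ?thesis using False by (simp add: c_def)
  next
    case True
    then have "(\<lambda>x. if x \<in> X then b' x else 0) = 0"
      by (intro ip_self_eq_0) (auto simp: ip_def)
    then have "b' x = 0" if "x \<in> X" for x using that by (auto dest: fun_cong[of _ _ x])
    then show ?thesis by (simp add: ip_def)
  qed
  moreover have B: "\<forall>a\<in>B. ip (v - uv - fscale c b') a = 0"
  proof
    fix a assume a: "a \<in> B"
    have "ip (v - uv - fscale c b') a = ip (v - uv) a - c * ip b' a" by (simp only: ip_linear)
    also have "\<dots> = 0" using a uv(2) ub(2) unfolding b'_def by simp
    finally show "ip (v - uv - fscale c b') a = 0" .
  qed
  moreover have "ip (v - uv - fscale c b') ub = 0" using orth[OF ub(1) B] .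
  moreover have "b = b' + ub" by (simp add: b'_def)
  ultimately have "ip (v - uv - fscale c b') b = 0" using ip_linear(5) by simp
  then have "\<forall>a\<in>insert b B. ip (v - (uv + fscale c b')) a = 0"
    using B by (simp add: diff_diff_eq)
  moreover have "uv + fscale c b' \<in> span (insert b B)"
    using uv(1) mono b' by (blast intro: span_add span_scale)
  ultimately show ?case by blast
qed

lemma in_span_unit_vectors:
  assumes "f \<in> rep_space V"
  shows "f \<in> span ((\<lambda>x y. if y = x then 1 else 0) ` X)"
proof -
  have "f = (\<Sum>x\<in>X. fscale (f x) (\<lambda>y. if y = x then 1 else 0))"
  proof
    fix y
    show "f y = (\<Sum>x\<in>X. fscale (f x) (\<lambda>y. if y = x then 1 else 0)) y"
      using fin supp[OF assms, of y] by (simp add: sum_apply if_distrib cong: if_cong)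
  qed
  also have "\<dots> \<in> span ((\<lambda>x y. if y = x then 1 else 0) ` X)"
    by (rule span_sum, rule span_scale, rule span_base) simp
  finally show ?thesis .
qed

lemma independent_finite:
  assumes "B \<subseteq> rep_space V" "independent B" shows "finite B"
  using independent_span_bound[OF finite_imageI[OF fin] assms(2)] in_span_unit_vectors assms(1) by blast

text \<open>
  The dimension is the measure of the induction that proves complete reducibility. As the ambient
  function space may be infinite-dimensional, the bound comes from a basis of \<open>U\<close>.
\<close>

lemma dim_strict_mono:
  assumes "subspace W" "W \<subset> U" "U \<subseteq> rep_space V" shows "dim W < dim U"
proof -
  obtain B where B: "B \<subseteq> W" "independent B" "W \<subseteq> span B" "card B = dim W" by (rule basis_exists)
  obtain C where C: "C \<subseteq> U" "independent C" "U \<subseteq> span C" "card C = dim U" by (rule basis_exists)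
  obtain u where u: "u \<in> U" "u \<notin> W" using assms(2) by blast
  have "span B \<subseteq> W" by (rule span_minimal[OF B(1) assms(1)])
  then have "u \<notin> span B" using u by blast
  then have "independent (insert u B)" using B(2) by (simp add: independent_insert)
  moreover have "insert u B \<subseteq> span C" using u B C assms by blast
  moreover have "finite C" "finite B" using independent_finite B C assms by (meson order.trans psubset_imp_subset)+
  ultimately have "card (insert u B) \<le> card C" using independent_span_bound by blast
  moreover have "u \<notin> B" using u B by blast
  ultimately show ?thesis using B C \<open>finite B\<close> by simp
qed

text \<open>
  The orthogonal complement of \<open>W\<close> in \<open>U\<close> is invariant since \<open>g\<close> is unitary:
  \<open>\<langle>g x, y\<rangle> = \<langle>x, g\<^sup>-\<^sup>1 y\<rangle> = 0\<close> for \<open>y \<in> W\<close>.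
\<close>

lemma invariant_complement:
  assumes U: "invariant_subspace G V U" and W: "invariant_subspace G V W" "W \<subseteq> U"
  obtains C where "invariant_subspace G V C" "C \<subseteq> U" "W \<inter> C = {0}"
    "\<And>u. u \<in> U \<Longrightarrow> \<exists>w\<in>W. \<exists>c\<in>C. u = w + c"
proof
  let ?C = "{u \<in> U. \<forall>w\<in>W. ip u w = 0}"
  note u = invariant_subspaceD[OF rep U] and w = invariant_subspaceD[OF rep W(1)]
  have sub: "subspace W" using W(1) scale by (simp add: invariant_subspace_def)
  show "invariant_subspace G V ?C"
  proof (rule invariant_subspaceI[OF rep])
    fix g x assume g: "g \<in> carrier G" and x: "x \<in> ?C"
    have "ip (rep_act V g x) y = 0" if y: "y \<in> W" for y
    proof -
      let ?h = "inv\<^bsub>G\<^esub> g"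
      have h: "?h \<in> carrier G" using g group by (simp add: group.inv_closed)
      have "rep_act V g (rep_act V ?h y) = rep_act V (g \<otimes>\<^bsub>G\<^esub> ?h) y"
        using rep_act_mult[OF rep g h] y w(1) by auto
      also have "\<dots> = y" using rep y w(1) g group by (auto simp: Defs.representation_def group.r_inv)
      finally have "ip (rep_act V g x) y = ip (rep_act V g x) (rep_act V g (rep_act V ?h y))" by simp
      also have "\<dots> = ip x (rep_act V ?h y)"
        unfolding ip_def using unitary[OF g] x u(1) w(1) w(5)[OF h y] by blast
      also have "\<dots> = 0" using x w(5)[OF h y] by blast
      finally show ?thesis .
    qed
    then show "rep_act V g x \<in> ?C" using x u(5)[OF g] by blast
  qed (use u scale in \<open>auto simp: ip_linear\<close>)
  show "?C \<subseteq> U" by blast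
  show "W \<inter> ?C = {0}"
  proof
    show "W \<inter> ?C \<subseteq> {0}"
    proof
      fix x assume x: "x \<in> W \<inter> ?C"
      then have "ip x x = 0" "x \<in> rep_space V" using w(1) by auto
      then show "x \<in> {0}" using ip_self_eq_0 supp by blast
    qed
    show "{0} \<subseteq> W \<inter> ?C" using u(2) w(2) by (simp add: ip_linear)
  qed
  fix v assume v: "v \<in> U"
  obtain B where B: "B \<subseteq> W" "independent B" "W \<subseteq> span B" by (rule basis_exists)
  have "finite B" using independent_finite B w(1) by blast
  then obtain p where p: "p \<in> span B" "\<forall>b\<in>B. ip (v - p) b = 0" using orthogonal_projection by blast
  have "p \<in> W" using p(1) span_minimal[OF B(1) sub] by blast
  have "ip (v - p) y = 0" if "y \<in> W" for y
  proof -
    have "y \<in> span B" using that B by blast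
    then show ?thesis
    proof (rule span_induct_alt)
      fix c x y assume "x \<in> B" "ip (v - p) y = 0"
      then show "ip (v - p) (fscale c x + y) = 0" using p(2) ip_linear(5,6) by simp
    qed (rule ip_linear)
  qed
  moreover have "v - p \<in> U"
  proof -
    have "v + rep_scale V (-1) p \<in> U" using u(3)[OF v u(4)] \<open>p \<in> W\<close> W(2) by blast
    moreover have "v + rep_scale V (-1) p = v - p" by (simp add: scale fun_eq_iff)
    ultimately show ?thesis by simp
  qed
  ultimately have "v - p \<in> ?C" by blast
  moreover have "v = p + (v - p)" by simp
  ultimately show "\<exists>w\<in>W. \<exists>c\<in>?C. v = w + c" using \<open>p \<in> W\<close> by blast
qed

lemma irreducible_decomposition_append:
  assumes D: "irreducible_decomposition G (V\<lparr>rep_space := W\<rparr>) As"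
      "irreducible_decomposition G (V\<lparr>rep_space := C\<rparr>) Bs"
    and U: "invariant_subspace G V U"
    and W: "invariant_subspace G V W" "W \<subseteq> U" and C: "invariant_subspace G V C" "C \<subseteq> U"
    and disj: "W \<inter> C = {0}" and ex: "\<And>u. u \<in> U \<Longrightarrow> \<exists>w\<in>W. \<exists>c\<in>C. u = w + c"
  shows "irreducible_decomposition G (V\<lparr>rep_space := U\<rparr>) (As @ Bs)"
proof -
  have WV: "W \<subseteq> rep_space V" "C \<subseteq> rep_space V" "U \<subseteq> rep_space V"
    using W C U by (auto simp: invariant_subspace_def)
  have sum_in: "sum_list ws \<in> Z"
    if "list_all2 (\<in>) ws Ws" "\<And>Y. Y \<in> set Ws \<Longrightarrow> Y \<subseteq> Z" "invariant_subspace G V Z" for ws Ws Z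
    using that(1,2)
  proof (induction rule: list_all2_induct)
    case Nil then show ?case using invariant_subspaceD(2)[OF rep that(3)] by (simp only: sum_list.Nil)
  next
    case (Cons y ys Y Ys)
    then have "y \<in> Z" "sum_list ys \<in> Z" by auto
    from invariant_subspaceD(3)[OF rep that(3) this] show ?case by (simp only: sum_list.Cons)
  qed
  have AW: "Y \<subseteq> W" if "Y \<in> set As" for Y
    using D(1) that by (auto simp: irreducible_decomposition_def invariant_subspace_def)
  have BC: "Y \<subseteq> C" if "Y \<in> set Bs" for Y
    using D(2) that by (auto simp: irreducible_decomposition_def invariant_subspace_def)
  have irr: "invariant_subspace G (V\<lparr>rep_space := U\<rparr>) Y \<and> irreducible_rep G (V\<lparr>rep_space := Y\<rparr>)"
    if "Y \<in> set (As @ Bs)" for Y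
  proof -
    have "Y \<subseteq> U" using that AW[of Y] BC[of Y] W(2) C(2) by auto
    then show ?thesis
      using that D by (auto simp: irreducible_decomposition_def invariant_subspace_subrep WV)
  qed
  have uni: "\<exists>!ws. list_all2 (\<in>) ws (As @ Bs) \<and> sum_list ws = v" if v: "v \<in> U" for v
  proof -
    obtain w c where wc: "w \<in> W" "c \<in> C" "v = w + c" using ex v by blast
    have exA: "\<exists>!ws. list_all2 (\<in>) ws As \<and> sum_list ws = w"
      using D(1) wc(1) by (simp add: irreducible_decomposition_def)
    have exB: "\<exists>!ws. list_all2 (\<in>) ws Bs \<and> sum_list ws = c"
      using D(2) wc(2) by (simp add: irreducible_decomposition_def)
    obtain ws cs where ws: "list_all2 (\<in>) ws As" "sum_list ws = w"
      and cs: "list_all2 (\<in>) cs Bs" "sum_list cs = c" using exA exB by blast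
    show ?thesis
    proof (rule ex1I[of _ "ws @ cs"])
      show "list_all2 (\<in>) (ws @ cs) (As @ Bs) \<and> sum_list (ws @ cs) = v"
        using ws cs wc by (simp add: list_all2_appendI)
      fix zs assume zs: "list_all2 (\<in>) zs (As @ Bs) \<and> sum_list zs = v"
      then obtain xs ys where xy: "zs = xs @ ys" "list_all2 (\<in>) xs As" "list_all2 (\<in>) ys Bs"
        by (auto simp: list_all2_append2)
      have x: "sum_list xs \<in> W" using sum_in[OF xy(2) AW W(1)] .
      have y: "sum_list ys \<in> C" using sum_in[OF xy(3) BC C(1)] .
      have "sum_list xs + sum_list ys = w + c" using zs xy wc by simp
      then have eq: "sum_list xs - w = c - sum_list ys" by (simp add: algebra_simps)
      have diff: "a - b \<in> Z" if "a \<in> Z" "b \<in> Z" "invariant_subspace G V Z" for a b Z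
      proof -
        have "subspace Z" using that(3) scale by (simp add: invariant_subspace_def)
        then show ?thesis using that(1,2) by (rule subspace_diff)
      qed
      have "sum_list xs - w \<in> W \<inter> C"
        using diff[OF x wc(1) W(1)] diff[OF wc(2) y C(1)] eq by simp
      then have "sum_list xs = w" "sum_list ys = c" using disj eq by auto
      then have "xs = ws" "ys = cs" using exA exB xy ws cs by blast+
      then show "zs = ws @ cs" using xy by simp
    qed
  qed
  show ?thesis using irr uni by (auto simp: irreducible_decomposition_def)
qed

text \<open>
  Complete reducibility: split off the orthogonal complement of a proper invariant subspace until
  only irreducible pieces are left. The multiplicity in the theorem is defined by a choice of a
  decomposition, so that it says nothing unless one exists.
\<close>

theorem maschke:
  assumes "invariant_subspace G V U"
  shows "\<exists>Ws. irreducible_decomposition G (V\<lparr>rep_space := U\<rparr>) Ws"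
  using assms
proof (induction "dim U" arbitrary: U rule: less_induct)
  case less
  note U = less.prems
  have US: "U \<subseteq> rep_space V" using U by (simp add: invariant_subspace_def)
  consider "U = {0}" | "irreducible_rep G (V\<lparr>rep_space := U\<rparr>)"
    | W where "invariant_subspace G V W" "W \<subset> U" "W \<noteq> {0}"
    using subrepresentation[OF rep U] invariant_subspace_subrep[OF US]
    unfolding irreducible_rep_def by auto
  then show ?case
  proof cases
    case 1
    then show ?thesis by (intro exI[of _ "[]"]) (auto simp: irreducible_decomposition_def)
  next
    case 2
    have "\<exists>!ws. list_all2 (\<in>) ws [U] \<and> sum_list ws = v" if "v \<in> U" for v
      using that by (intro ex1I[of _ "[v]"]) (auto simp: list_all2_Cons2)
    then have "irreducible_decomposition G (V\<lparr>rep_space := U\<rparr>) [U]"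
      using 2 U US by (simp add: irreducible_decomposition_def invariant_subspace_subrep)
    then show ?thesis by blast
  next
    case (3 W)
    obtain C where C: "invariant_subspace G V C" "C \<subseteq> U" "W \<inter> C = {0}"
      "\<And>u. u \<in> U \<Longrightarrow> \<exists>w\<in>W. \<exists>c\<in>C. u = w + c"
      using invariant_complement[OF U 3(1)] 3(2) by blast
    have "C \<noteq> U" using C(3) 3 invariant_subspaceD(2)[OF rep 3(1)] by blast
    have sub: "subspace W" "subspace C" using 3(1) C(1) scale by (auto simp: invariant_subspace_def)
    have "dim W < dim U" "dim C < dim U"
      using dim_strict_mono[OF sub(1) 3(2) US] dim_strict_mono[OF sub(2) _ US] C(2) \<open>C \<noteq> U\<close> by auto
    then obtain As Bs where "irreducible_decomposition G (V\<lparr>rep_space := W\<rparr>) As"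
      "irreducible_decomposition G (V\<lparr>rep_space := C\<rparr>) Bs"
      using less.hyps 3(1) C(1) by blast
    then show ?thesis using irreducible_decomposition_append[OF _ _ U 3(1) _ C] 3(2) by blast
  qed
qed

lemma irreducible_decomposition_exists: "\<exists>Ws. irreducible_decomposition G V Ws"
proof -
  have "invariant_subspace G V (rep_space V)"
    using rep unfolding Defs.representation_def invariant_subspace_def by blast
  from maschke[OF this] show ?thesis by simp
qed

end


section \<open>Tableaux, tabloids and polytabloids\<close>

text \<open>
  Among the sets of \<open>k\<close> natural numbers, \<open>{0, \<dots>, k - 1}\<close> alone has the least sum. Applied to the rows
  that meet a column, this recognizes a Young diagram among all sets of cells.
\<close>

lemma sum_lessThan_card_le:
  fixes A :: "nat set"
  assumes "finite A"
  shows "\<Sum>{..<card A} \<le> \<Sum>A \<and> (\<Sum>{..<card A} = \<Sum>A \<longrightarrow> A = {..<card A})"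
  using assms
proof (induction "card A" arbitrary: A)
  case 0 then show ?case by simp
next
  case (Suc k)
  have "A \<noteq> {}" using Suc.hyps(2) by auto
  define m where "m = Max A"
  have m: "m \<in> A" "A \<subseteq> {..m}" using Suc.prems \<open>A \<noteq> {}\<close> by (auto simp: m_def)
  have "card A \<le> card {..m}" by (rule card_mono[OF _ m(2)]) simp
  then have km: "k \<le> m" using Suc.hyps(2) by simp
  have c: "card (A - {m}) = k" using Suc.hyps(2) m(1) Suc.prems by simp
  have IH: "\<Sum>{..<k} \<le> \<Sum>(A - {m}) \<and> (\<Sum>{..<k} = \<Sum>(A - {m}) \<longrightarrow> A - {m} = {..<k})"
    using Suc.hyps(1)[of "A - {m}"] c Suc.prems by simp
  have S: "\<Sum>A = m + \<Sum>(A - {m})" using Suc.prems m(1) by (simp add: sum.remove)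
  have T: "\<Sum>{..<card A} = k + \<Sum>{..<k}" using Suc.hyps(2) by (metis sum.lessThan_Suc add.commute)
  have "A = {..<card A}" if "\<Sum>{..<card A} = \<Sum>A"
  proof -
    have "m = k" "\<Sum>{..<k} = \<Sum>(A - {m})" using that IH km S T by linarith+
    then have "A = insert k {..<k}" using IH m(1) by blast
    then show ?thesis using Suc.hyps(2) by (metis lessThan_Suc)
  qed
  then show ?case using IH km S T by linarith
qed

lemma down_closed_eq_lessThan:
  fixes A :: "nat set"
  assumes "finite A" "\<And>i j. j \<in> A \<Longrightarrow> i \<le> j \<Longrightarrow> i \<in> A"
  shows "A = {..<card A}"
proof (cases "A = {}")
  case False
  then have "A = {..Max A}" using assms by (auto intro: Max_in)
  then show ?thesis by (metis card_lessThan lessThan_Suc_atMost)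
qed simp

lemma cells_Sigma: "cells la = (SIGMA i:{..<length la}. {..<la ! i})"
  by (auto simp: cells_def)

lemma finite_cells: "finite (cells la)"
  by (simp add: cells_Sigma)

lemma card_cells: "card (cells la) = sum_list la"
  by (simp add: cells_Sigma sum_list_sum_nth atLeast0LessThan)

lemma tableau_exists: "\<exists>t. tableau la t"
  unfolding tableau_def using finite_same_card_bij[OF finite_cells, of "{1..sum_list la}" la]
  by (simp add: card_cells)

lemma tableauD:
  assumes "tableau la t"
  shows "inj_on t (cells la)" "t ` cells la = {1..sum_list la}"
  using assms by (auto simp: tableau_def bij_betw_def)

lemma tableau_inv:
  assumes "tableau la t" "x \<in> {1..sum_list la}"
  shows "inv_into (cells la) t x \<in> cells la" "t (inv_into (cells la) t x) = x"
  using assms tableauD(2)[OF assms(1)] by (metis inv_into_into, metis f_inv_into_f)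

lemma perm_tabloid_tabloid: "perm_tabloid p (tabloid la t) = tabloid la (p \<circ> t)"
  by (auto simp: perm_tabloid_def tabloid_def)

lemma perm_tabloid_comp: "perm_tabloid p (perm_tabloid q T) = perm_tabloid (p \<circ> q) T"
  by (simp add: perm_tabloid_def image_comp)

lemma perm_tabloid_id [simp]: "perm_tabloid id T = T"
  by (simp add: perm_tabloid_def)

lemma perm_tabloid_inv:
  assumes "p permutes A"
  shows "perm_tabloid p (perm_tabloid (inv' p) T) = T" "perm_tabloid (inv' p) (perm_tabloid p T) = T"
  using permutes_inv_o[OF assms] by (simp_all add: perm_tabloid_comp)

lemma tableau_comp:
  assumes "tableau la t" "p permutes {1..sum_list la}" shows "tableau la (p \<circ> t)"
  using assms permutes_imp_bij bij_betw_trans unfolding tableau_def by blast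

definition tabloids :: "nat list \<Rightarrow> nat set list set"
  where "tabloids la = {T. \<exists>t. tableau la t \<and> T = tabloid la t}"

lemma tabloid_in_tabloids: "tableau la t \<Longrightarrow> tabloid la t \<in> tabloids la"
  by (auto simp: tabloids_def)

lemma finite_tabloids: "finite (tabloids la)"
proof (rule finite_subset)
  show "tabloids la \<subseteq> {T. set T \<subseteq> Pow {1..sum_list la} \<and> length T = length la}"
  proof
    fix T assume "T \<in> tabloids la"
    then obtain t where t: "tableau la t" "T = tabloid la t" by (auto simp: tabloids_def)
    have "t c \<in> {1..sum_list la}" if "c \<in> cells la" for c using tableauD(2)[OF t(1)] that by blast
    then show "T \<in> {T. set T \<subseteq> Pow {1..sum_list la} \<and> length T = length la}"
      unfolding t(2) tabloid_def by fastforce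
  qed
qed (simp add: finite_lists_length_eq)

lemma perm_tabloid_in_tabloids:
  assumes "p permutes {1..sum_list la}" "T \<in> tabloids la"
  shows "perm_tabloid p T \<in> tabloids la"
proof -
  obtain t where t: "tableau la t" "T = tabloid la t" using assms(2) by (auto simp: tabloids_def)
  then show ?thesis using tabloid_in_tabloids[OF tableau_comp[OF t(1) assms(1)]]
    by (simp add: perm_tabloid_tabloid)
qed

lemma rep_space_tabloid_module:
  "rep_space (tabloid_module la) = {f. \<forall>T. T \<notin> tabloids la \<longrightarrow> f T = 0}"
  by (auto simp: tabloid_module_def tabloids_def)

lemma rep_scale_tabloid_module: "rep_scale (tabloid_module la) = (\<lambda>c f T. c * f T)"
  and rep_act_tabloid_module: "rep_act (tabloid_module la) p f = (\<lambda>T. f (perm_tabloid (inv' p) T))"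
  by (simp_all add: tabloid_module_def)

lemma representation_tabloid_module:
  "representation (sym_group (sum_list la)) (tabloid_module la)"
proof -
  have "perm_tabloid (inv' p) T \<notin> tabloids la"
    if "p permutes {1..sum_list la}" "T \<notin> tabloids la" for p T
    using that perm_tabloid_in_tabloids perm_tabloid_inv by metis
  moreover have "perm_tabloid (inv' (g \<circ> h)) T = perm_tabloid (inv' h \<circ> inv' g) T"
    if "g permutes {1..sum_list la}" "h permutes {1..sum_list la}" for g h T
    using that by (simp add: o_inv_distrib permutes_bij)
  ultimately show ?thesis
    unfolding Defs.representation_def rep_space_tabloid_module rep_scale_tabloid_module
      rep_act_tabloid_module subspace_iff[OF vector_space_fun]
    by (auto simp: vector_space_fun sym_group_def perm_tabloid_comp fun_eq_iff simp del: One_nat_def)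
qed

definition column :: "nat list \<Rightarrow> (nat \<times> nat \<Rightarrow> nat) \<Rightarrow> nat \<Rightarrow> nat set"
  where "column la t j = {t (i, j) |i. (i, j) \<in> cells la}"

lemma column_stabilizer_iff:
  "p \<in> column_stabilizer la t \<longleftrightarrow>
    p permutes {1..sum_list la} \<and> (\<forall>j. p ` column la t j = column la t j)"
  by (simp add: column_stabilizer_def column_def sym_group_def)

lemma column_stabilizer_id: "id \<in> column_stabilizer la t"
  by (simp add: column_stabilizer_iff permutes_id)

lemma column_stabilizer_comp:
  "p \<in> column_stabilizer la t \<Longrightarrow> q \<in> column_stabilizer la t \<Longrightarrow> p \<circ> q \<in> column_stabilizer la t"
  unfolding column_stabilizer_iff by (metis permutes_compose image_comp)

lemma column_stabilizer_inv:
  assumes "p \<in> column_stabilizer la t" shows "inv' p \<in> column_stabilizer la t"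
proof -
  have p: "p permutes {1..sum_list la}" "\<And>j. p ` column la t j = column la t j"
    using assms by (auto simp: column_stabilizer_iff)
  have "inv' p ` column la t j = column la t j" for j
  proof -
    have "inv' p ` (p ` column la t j) = column la t j"
      using permutes_inv_o(2)[OF p(1)] by (simp add: image_comp)
    then show ?thesis using p(2) by simp
  qed
  then show ?thesis using p(1) by (simp add: column_stabilizer_iff permutes_inv)
qed

lemma column_stabilizer_permutation: "p \<in> column_stabilizer la t \<Longrightarrow> permutation p"
  by (auto simp: column_stabilizer_iff permutation_permutes)

lemma finite_column_stabilizer: "finite (column_stabilizer la t)"
  by (rule finite_subset[OF _ finite_permutations[of "{1..sum_list la}"]])
    (auto simp: column_stabilizer_iff)

lemma column_stabilizer_conj:
  assumes "p permutes {1..sum_list la}" "q \<in> column_stabilizer la t"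
  shows "p \<circ> q \<circ> inv' p \<in> column_stabilizer la (p \<circ> t)"
proof -
  have col: "column la (p \<circ> t) j = p ` column la t j" for j by (auto simp: column_def)
  have q: "q permutes {1..sum_list la}" "\<And>j. q ` column la t j = column la t j"
    using assms(2) by (auto simp: column_stabilizer_iff)
  have "(p \<circ> q \<circ> inv' p) ` column la (p \<circ> t) j = column la (p \<circ> t) j" for j
  proof -
    have "inv' p ` p ` column la t j = column la t j"
      using permutes_inv_o(2)[OF assms(1)] by (simp add: image_comp)
    then show ?thesis unfolding col image_comp[symmetric] using q(2) by simp
  qed
  then show ?thesis
    using assms(1) q(1) by (simp add: column_stabilizer_iff permutes_compose permutes_inv)
qed

lemma polytabloid_cong:
  assumes "\<And>c. c \<in> cells la \<Longrightarrow> t c = s c"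
  shows "polytabloid la t = polytabloid la s"
proof -
  have 1: "column la t = column la s"
    unfolding column_def by (intro ext Collect_cong) (metis assms)
  have 2: "column_stabilizer la t = column_stabilizer la s"
    by (auto simp: column_stabilizer_iff 1)
  have 3: "tabloid la t = tabloid la s"
    unfolding tabloid_def by (intro map_cong refl Collect_cong) (metis assms)
  show ?thesis unfolding polytabloid_def 2 3 by simp
qed

lemma tableau_transitive:
  assumes "tableau la t" "tableau la s"
  obtains q where "q permutes {1..sum_list la}" "\<And>c. c \<in> cells la \<Longrightarrow> q (t c) = s c"
proof
  let ?N = "{1..sum_list la}"
  let ?q = "\<lambda>x. if x \<in> ?N then s (inv_into (cells la) t x) else x"
  have "bij_betw (s \<circ> inv_into (cells la) t) ?N ?N"
    using assms bij_betw_inv_into bij_betw_trans unfolding tableau_def by blast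
  then have "bij_betw ?q ?N ?N" by (rule bij_betw_cong[THEN iffD1, rotated]) simp
  then show "?q permutes ?N" by (rule bij_imp_permutes) auto
  fix c assume c: "c \<in> cells la"
  then have "t c \<in> ?N" using tableauD(2)[OF assms(1)] by blast
  then show "?q (t c) = s c" using c tableauD(1)[OF assms(1)] by simp
qed

lemma polytabloid_in_module:
  assumes "tableau la t" shows "polytabloid la t \<in> rep_space (tabloid_module la)"
  unfolding rep_space_tabloid_module polytabloid_def
  using perm_tabloid_in_tabloids[OF _ tabloid_in_tabloids[OF assms]]
  by (auto simp: column_stabilizer_iff intro!: sum.neutral)

text \<open>
  Conjugation by \<open>p\<close> maps the column stabilizer of \<open>t\<close> onto that of \<open>p \<circ> t\<close>, so the orbit of one
  polytabloid consists of all of them.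
\<close>

lemma polytabloid_act:
  assumes "p permutes {1..sum_list la}"
  shows "rep_act (tabloid_module la) p (polytabloid la t) = polytabloid la (p \<circ> t)"
proof
  fix T
  have ip: "inv' p permutes {1..sum_list la}" using assms by (rule permutes_inv)
  have pp: "inv' p \<circ> p = id" "p \<circ> inv' p = id" using permutes_inv_o[OF assms] by auto
  show "rep_act (tabloid_module la) p (polytabloid la t) T = polytabloid la (p \<circ> t) T"
    unfolding rep_act_tabloid_module polytabloid_def
  proof (rule sum.reindex_bij_witness[where i = "\<lambda>q. inv' p \<circ> q \<circ> p" and j = "\<lambda>q. p \<circ> q \<circ> inv' p"])
    fix q assume q: "q \<in> column_stabilizer la t"
    show "inv' p \<circ> (p \<circ> q \<circ> inv' p) \<circ> p = q"
      using pp by (metis comp_assoc comp_id id_comp)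
    show "p \<circ> q \<circ> inv' p \<in> column_stabilizer la (p \<circ> t)"
      by (rule column_stabilizer_conj[OF assms q])
    have "permutation p" "permutation (inv' p)" "permutation q"
      using assms ip column_stabilizer_permutation[OF q] by (auto simp: permutation_permutes)
    then have sgn: "sign (p \<circ> q \<circ> inv' p) = sign q"
      by (simp add: sign_compose sign_inverse permutation_compose)
    have "T = perm_tabloid (p \<circ> q \<circ> inv' p) (tabloid la (p \<circ> t)) \<longleftrightarrow>
        T = perm_tabloid p (perm_tabloid q (tabloid la t))"
      using pp by (simp add: perm_tabloid_comp perm_tabloid_tabloid[symmetric] comp_assoc)
    also have "\<dots> \<longleftrightarrow> perm_tabloid (inv' p) T = perm_tabloid q (tabloid la t)"
      using perm_tabloid_inv[OF assms] by metis
    finally show "of_int (sign (p \<circ> q \<circ> inv' p)) *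
          (if T = perm_tabloid (p \<circ> q \<circ> inv' p) (tabloid la (p \<circ> t)) then 1 else 0) =
        of_int (sign q) * (if perm_tabloid (inv' p) T = perm_tabloid q (tabloid la t) then 1 else 0)"
      using sgn by simp
  next
    fix q assume q: "q \<in> column_stabilizer la (p \<circ> t)"
    show "p \<circ> (inv' p \<circ> q \<circ> p) \<circ> inv' p = q"
      using pp by (metis comp_assoc comp_id id_comp)
    have "inv' p \<circ> q \<circ> inv' (inv' p) \<in> column_stabilizer la (inv' p \<circ> (p \<circ> t))"
      by (rule column_stabilizer_conj[OF ip q])
    then show "inv' p \<circ> q \<circ> p \<in> column_stabilizer la t"
      using pp(1) permutes_inv_inv[OF assms] by (metis comp_assoc id_comp)
  qed
qed


section \<open>Irreducibility of Specht modules\<close>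

text \<open>
  The functions that the column stabilizer of \<open>t\<close> transforms by its sign character.
\<close>

definition alternating :: "nat list \<Rightarrow> (nat \<times> nat \<Rightarrow> nat) \<Rightarrow> (nat set list \<Rightarrow> complex) \<Rightarrow> bool"
  where "alternating la t f \<longleftrightarrow>
    (\<forall>q\<in>column_stabilizer la t. \<forall>T. f (perm_tabloid q T) = of_int (sign q) * f T)"

lemma alternating_polytabloid: "alternating la t (polytabloid la t)"
  unfolding alternating_def
proof (intro ballI allI)
  fix q T assume q: "q \<in> column_stabilizer la t"
  have qp: "q permutes {1..sum_list la}" using q by (simp add: column_stabilizer_iff)
  note qq = permutes_inv_o[OF qp]
  show "polytabloid la t (perm_tabloid q T) = of_int (sign q) * polytabloid la t T"
    unfolding polytabloid_def sum_distrib_left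
  proof (rule sum.reindex_bij_witness[where i = "\<lambda>p. q \<circ> p" and j = "\<lambda>p. inv' q \<circ> p"])
    fix p assume p: "p \<in> column_stabilizer la t"
    show "q \<circ> (inv' q \<circ> p) = p" "inv' q \<circ> (q \<circ> p) = p"
      using qq by (simp_all add: comp_assoc[symmetric])
    show "inv' q \<circ> p \<in> column_stabilizer la t" "q \<circ> p \<in> column_stabilizer la t"
      using p q by (simp_all add: column_stabilizer_comp column_stabilizer_inv)
    have sg: "sign (inv' q \<circ> p) = sign q * sign p"
      using column_stabilizer_permutation[OF p] column_stabilizer_permutation[OF q]
        column_stabilizer_permutation[OF column_stabilizer_inv[OF q]]
      by (simp add: sign_compose sign_inverse)
    have "sign q * (sign q * sign p) = sign p" by (simp add: sign_def)
    then have "of_int (sign q) * (of_int (sign q * sign p)) = (of_int (sign p) :: complex)"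
      by (metis of_int_mult)
    moreover have "T = perm_tabloid (inv' q \<circ> p) (tabloid la t) \<longleftrightarrow>
        perm_tabloid q T = perm_tabloid p (tabloid la t)"
      using perm_tabloid_inv[OF qp] by (metis perm_tabloid_comp)
    ultimately show "of_int (sign q) * (of_int (sign (inv' q \<circ> p)) *
          (if T = perm_tabloid (inv' q \<circ> p) (tabloid la t) then 1 else 0)) =
        of_int (sign p) * (if perm_tabloid q T = perm_tabloid p (tabloid la t) then 1 else (0::complex))"
      using sg by simp
  qed
qed

lemma column_and_row_stabilizer:
  assumes t: "tableau la t" and p: "p \<in> column_stabilizer la t"
    and row: "perm_tabloid p (tabloid la t) = tabloid la t"
  shows "p = id"
proof
  fix x
  have pp: "p permutes {1..sum_list la}" using p by (simp add: column_stabilizer_iff)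
  show "p x = id x"
  proof (cases "x \<in> {1..sum_list la}")
    case False then show ?thesis using permutes_not_in[OF pp] by simp
  next
    case True
    then obtain i j where ij: "(i, j) \<in> cells la" "x = t (i, j)"
      using tableauD(2)[OF t] by (metis imageE surj_pair)
    have "p x \<in> p ` column la t j" using ij by (auto simp: column_def)
    also have "\<dots> = column la t j" using p by (simp add: column_stabilizer_iff)
    finally obtain i' where i': "(i', j) \<in> cells la" "p x = t (i', j)" by (auto simp: column_def)
    have i: "i < length la" using ij by (simp add: cells_def)
    have "p x \<in> perm_tabloid p (tabloid la t) ! i"
      using ij i by (auto simp: perm_tabloid_def tabloid_def)
    then obtain j' where j': "(i, j') \<in> cells la" "p x = t (i, j')"
      unfolding row using i by (auto simp: tabloid_def)
    have "(i', j) = (i, j')" using inj_onD[OF tableauD(1)[OF t]] i' j' by metis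
    then show ?thesis using ij i' by simp
  qed
qed

lemma polytabloid_at_tabloid:
  assumes "tableau la t" shows "polytabloid la t (tabloid la t) = 1"
proof -
  have "polytabloid la t (tabloid la t) = (\<Sum>p\<in>column_stabilizer la t. if p = id then 1 else 0)"
    unfolding polytabloid_def
    by (rule sum.cong) (use column_and_row_stabilizer[OF assms] in \<open>force simp: sign_id\<close>)+
  also have "\<dots> = 1" using finite_column_stabilizer column_stabilizer_id by (simp add: sum.delta)
  finally show ?thesis .
qed

text \<open>
  The combinatorial heart of the theory of Specht modules. Suppose no two entries share both a row of
  \<open>s\<close> and a column of \<open>t\<close>, so that \<open>x \<mapsto> (row of x in s, column of x in t)\<close> is injective. Add up the
  rows of all entries in \<open>s\<close>, column of \<open>t\<close> by column of \<open>t\<close>. In a column with \<open>h\<close> entries, these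
  rows are distinct, so they contribute at least \<open>0 + \<dots> + (h - 1)\<close>. The total is the same as for the
  diagram itself, where every column attains this bound, hence every column attains it here too and
  has its entries in the rows \<open>0, \<dots>, h - 1\<close> of \<open>s\<close>. Moving each entry, within its column of \<open>t\<close>, to its
  row in \<open>s\<close> is then a column permutation that turns \<open>s\<close> into \<open>t\<close> up to row equivalence.
\<close>

lemma tabloid_in_column_orbit:
  assumes sorted: "sorted_wrt (\<ge>) la" and t: "tableau la t" and s: "tableau la s"
    and inj: "inj_on (\<lambda>x. (fst (inv_into (cells la) s x), snd (inv_into (cells la) t x))) {1..sum_list la}"
  shows "\<exists>q\<in>column_stabilizer la t. tabloid la s = perm_tabloid q (tabloid la t)"
proof -
  let ?N = "{1..sum_list la}"
  define r where "r x = fst (inv_into (cells la) s x)" for x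
  define c where "c x = snd (inv_into (cells la) t x)" for x
  define J where "J = snd ` cells la"
  define D where "D j = {x \<in> ?N. c x = j}" for j
  define K where "K j = {a \<in> cells la. snd a = j}" for j
  have injrc: "inj_on (\<lambda>x. (r x, c x)) ?N" using inj by (simp add: r_def c_def)
  have r_s: "r (s a) = fst a" and c_t: "c (t a) = snd a" if "a \<in> cells la" for a
    using that tableauD(1)[OF s] tableauD(1)[OF t] by (simp_all add: r_def c_def)
  have D_image: "D j = t ` K j" for j
  proof (intro equalityI subsetI)
    fix x assume "x \<in> D j"
    then have "inv_into (cells la) t x \<in> K j" "t (inv_into (cells la) t x) = x"
      using tableau_inv[OF t, of x] by (simp_all add: D_def K_def c_def)
    then show "x \<in> t ` K j" by force
  next
    fix x assume "x \<in> t ` K j"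
    then show "x \<in> D j" using tableauD(2)[OF t] c_t by (auto simp: D_def K_def)
  qed
  have D_column: "D j = column la t j" for j
    unfolding D_image by (force simp: K_def column_def)
  have fin: "finite (K j)" "finite (D j)" for j
    using finite_cells by (simp_all add: K_def D_def)
  have card_D: "card (D j) = card (K j)" for j
    unfolding D_image using tableauD(1)[OF t] by (intro card_image) (auto simp: K_def inj_on_def)
  have K_fst: "fst ` K j = {..<card (K j)}" "inj_on fst (K j)" for j
  proof -
    show i: "inj_on fst (K j)" by (auto simp: K_def inj_on_def)
    have "i' \<in> fst ` K j" if "i \<in> fst ` K j" "i' \<le> i" for i i'
    proof -
      have "i < length la" "j < la ! i" using that(1) by (auto simp: K_def cells_def)
      then have "(i', j) \<in> K j" using that(2) sorted_wrt_nth_less[OF sorted, of i' i]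
        by (cases "i' = i") (auto simp: K_def cells_def)
      then show ?thesis by force
    qed
    then have "fst ` K j = {..<card (fst ` K j)}"
      using fin by (intro down_closed_eq_lessThan) auto
    then show "fst ` K j = {..<card (K j)}" using card_image[OF i] by simp
  qed
  have inj_r: "inj_on r (D j)" for j
    using injrc by (auto simp: D_def inj_on_def)
  have le: "(\<Sum>a\<in>K j. fst a) \<le> (\<Sum>x\<in>D j. r x)"
    and eq: "(\<Sum>a\<in>K j. fst a) = (\<Sum>x\<in>D j. r x) \<Longrightarrow> r ` D j = {..<card (K j)}" for j
  proof -
    have "(\<Sum>a\<in>K j. fst a) = \<Sum>(fst ` K j)" using sum.reindex[OF K_fst(2), of "\<lambda>x. x"] by simp
    also have "fst ` K j = {..<card (r ` D j)}"
      using K_fst(1) card_image[OF inj_r] card_D by simp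
    finally have 1: "(\<Sum>a\<in>K j. fst a) = \<Sum>{..<card (r ` D j)}" .
    have 2: "(\<Sum>x\<in>D j. r x) = \<Sum>(r ` D j)" using sum.reindex[OF inj_r, of "\<lambda>x. x"] by simp
    have 3: "card (r ` D j) = card (K j)" using card_image[OF inj_r] card_D by simp
    note 4 = sum_lessThan_card_le[OF finite_imageI[OF fin(2)], of r j]
    show "(\<Sum>a\<in>K j. fst a) \<le> (\<Sum>x\<in>D j. r x)" unfolding 1 2 using 4 by blast
    assume "(\<Sum>a\<in>K j. fst a) = (\<Sum>x\<in>D j. r x)"
    then show "r ` D j = {..<card (K j)}" unfolding 1 2 using 4 3 by argo
  qed
  have "(\<Sum>j\<in>J. \<Sum>a\<in>K j. fst a) = (\<Sum>a\<in>cells la. fst a)"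
    unfolding K_def J_def by (rule sum.group) (use finite_cells in auto)
  also have "\<dots> = (\<Sum>a\<in>cells la. r (s a))" using r_s by simp
  also have "\<dots> = (\<Sum>x\<in>?N. r x)"
    using sum.reindex[OF tableauD(1)[OF s], of r] tableauD(2)[OF s] by simp
  also have "\<dots> = (\<Sum>j\<in>J. \<Sum>x\<in>D j. r x)"
    unfolding D_def J_def
    by (rule sum.group[symmetric]) (use finite_cells tableau_inv(1)[OF t] in \<open>auto simp: c_def\<close>)
  finally have sums: "(\<Sum>j\<in>J. \<Sum>a\<in>K j. fst a) = (\<Sum>j\<in>J. \<Sum>x\<in>D j. r x)" .
  have "finite J" using finite_cells by (simp add: J_def)
  then have rD: "r ` D j = {..<card (K j)}" if "j \<in> J" for j
    using sum_mono_inv[OF sums le that] eq by blast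
  have rc: "(r x, c x) \<in> cells la" if "x \<in> ?N" for x
  proof -
    have "c x \<in> J" using tableau_inv(1)[OF t that] by (auto simp: c_def J_def)
    moreover have "x \<in> D (c x)" using that by (simp add: D_def)
    ultimately have "r x \<in> fst ` K (c x)" using rD K_fst(1) by blast
    then show ?thesis by (auto simp: K_def)
  qed
  define p where "p x = (if x \<in> ?N then t (r x, c x) else x)" for x
  have p_in: "p ` ?N \<subseteq> ?N" using rc tableauD(2)[OF t] by (auto simp: p_def)
  have inj_p: "inj_on p ?N"
  proof (rule inj_onI)
    fix x y assume "x \<in> ?N" "y \<in> ?N" "p x = p y"
    then have "(r x, c x) = (r y, c y)"
      using inj_onD[OF tableauD(1)[OF t]] rc unfolding p_def by metis
    then show "x = y" using inj_onD[OF injrc] \<open>x \<in> ?N\<close> \<open>y \<in> ?N\<close> by metis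
  qed
  have surj_p: "p ` ?N = ?N" by (rule endo_inj_surj[OF _ p_in inj_p]) simp
  have perm: "p permutes ?N"
    by (rule bij_imp_permutes) (use inj_p surj_p in \<open>auto simp: bij_betw_def p_def\<close>)
  have "p ` D j = D j" for j
  proof (rule endo_inj_surj)
    show "p ` D j \<subseteq> D j"
    proof
      fix y assume "y \<in> p ` D j"
      then obtain x where x: "x \<in> ?N" "c x = j" "y = p x" by (auto simp: D_def)
      then have "y = t (r x, j)" "(r x, j) \<in> cells la" using rc[of x] by (auto simp: p_def)
      then show "y \<in> D j" using D_image by (auto simp: K_def)
    qed
    show "inj_on p (D j)" by (rule inj_on_subset[OF inj_p]) (auto simp: D_def)
  qed (rule fin)
  then have pC: "p \<in> column_stabilizer la t"
    using perm by (simp add: column_stabilizer_iff D_column)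
  have "perm_tabloid p (tabloid la s) = tabloid la t"
  proof (rule nth_equalityI)
    fix i assume "i < length (perm_tabloid p (tabloid la s))"
    then have i: "i < length la" by (simp add: perm_tabloid_def tabloid_def)
    have "p ` {s (i, j) |j. (i, j) \<in> cells la} = {t (i, j) |j. (i, j) \<in> cells la}"
    proof (intro equalityI subsetI)
      fix y assume "y \<in> p ` {s (i, j) |j. (i, j) \<in> cells la}"
      then obtain j where j: "(i, j) \<in> cells la" "y = p (s (i, j))" by blast
      have "s (i, j) \<in> ?N" using tableauD(2)[OF s] j by blast
      then show "y \<in> {t (i, j) |j. (i, j) \<in> cells la}"
        using rc[of "s (i, j)"] r_s[OF j(1)] j by (auto simp: p_def)
    next
      fix y assume "y \<in> {t (i, j) |j. (i, j) \<in> cells la}"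
      then obtain j where j: "(i, j) \<in> cells la" "y = t (i, j)" by blast
      then have "y \<in> p ` ?N" using surj_p tableauD(2)[OF t] by blast
      then obtain x where x: "x \<in> ?N" "p x = y" by blast
      then have "(r x, c x) = (i, j)"
        using inj_onD[OF tableauD(1)[OF t] _ rc[OF x(1)] j(1)] j by (simp add: p_def)
      then have "inv_into (cells la) s x = (i, snd (inv_into (cells la) s x))"
        by (simp add: r_def prod_eq_iff)
      then show "y \<in> p ` {s (i, j) |j. (i, j) \<in> cells la}"
        using tableau_inv[OF s x(1)] x(2) by (smt (verit) image_iff mem_Collect_eq)
    qed
    then show "perm_tabloid p (tabloid la s) ! i = tabloid la t ! i"
      using i by (simp add: perm_tabloid_def tabloid_def)
  qed (simp add: perm_tabloid_def tabloid_def)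
  then have "tabloid la s = perm_tabloid (inv' p) (tabloid la t)"
    using perm_tabloid_inv(2)[OF perm] by metis
  then show ?thesis using column_stabilizer_inv[OF pC] by blast
qed

text \<open>
  Up to scalars there is only one alternating vector, because its value at a tabloid \<open>{s}\<close> is forced.
  If two entries share a row of \<open>s\<close> and a column of \<open>t\<close>, their transposition fixes \<open>{s}\<close> and is odd,
  so the value vanishes; otherwise \<open>{s}\<close> lies in the orbit of \<open>{t}\<close> under the column stabilizer.
  Irreducibility of the Specht module and the determination of its endomorphisms both rest on this.
\<close>

lemma alternating_eq_multiple_polytabloid:
  assumes sorted: "sorted_wrt (\<ge>) la" and t: "tableau la t"
    and f: "f \<in> rep_space (tabloid_module la)" "alternating la t f"
  shows "f = (\<lambda>T. f (tabloid la t) * polytabloid la t T)"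
proof
  fix T
  show "f T = f (tabloid la t) * polytabloid la t T"
  proof (cases "T \<in> tabloids la")
    case False
    then show ?thesis using f(1) polytabloid_in_module[OF t] by (simp add: rep_space_tabloid_module)
  next
    case True
    then obtain s where s: "tableau la s" "T = tabloid la s" by (auto simp: tabloids_def)
    let ?rc = "\<lambda>x. (fst (inv_into (cells la) s x), snd (inv_into (cells la) t x))"
    show ?thesis
    proof (cases "inj_on ?rc {1..sum_list la}")
      case inj: True
      obtain q where q: "q \<in> column_stabilizer la t" "T = perm_tabloid q (tabloid la t)"
        using tabloid_in_column_orbit[OF sorted t s(1) inj] s(2) by blast
      have g: "g T = of_int (sign q) * g (tabloid la t)" if "alternating la t g" for g
        using that q by (simp add: alternating_def)
      show ?thesis
        using g[OF f(2)] g[OF alternating_polytabloid] polytabloid_at_tabloid[OF t] by simp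
    next
      case False
      then obtain a b where ab: "a \<in> {1..sum_list la}" "b \<in> {1..sum_list la}" "a \<noteq> b"
        and same: "fst (inv_into (cells la) s a) = fst (inv_into (cells la) s b)"
          "snd (inv_into (cells la) t a) = snd (inv_into (cells la) t b)"
        by (auto simp: inj_on_def)
      let ?q = "transpose a b"
      have perm: "?q permutes {1..sum_list la}" using ab by (simp add: permutes_swap_id)
      have "a \<in> column la t j \<longleftrightarrow> b \<in> column la t j" for j
      proof -
        have "x \<in> column la t j \<longleftrightarrow> snd (inv_into (cells la) t x) = j" if "x \<in> {1..sum_list la}" for x
          using tableau_inv[OF t that] tableauD(1)[OF t] unfolding column_def
          by (smt (verit, best) inv_into_f_f mem_Collect_eq prod.collapse snd_conv)
        then show ?thesis using ab same by simp
      qed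
      then have q: "?q \<in> column_stabilizer la t"
        using perm by (simp add: column_stabilizer_iff transpose_image_eq)
      have "a \<in> {s (i, j) |j. (i, j) \<in> cells la} \<longleftrightarrow> b \<in> {s (i, j) |j. (i, j) \<in> cells la}" for i
      proof -
        have "x \<in> {s (i, j) |j. (i, j) \<in> cells la} \<longleftrightarrow> fst (inv_into (cells la) s x) = i"
          if "x \<in> {1..sum_list la}" for x
          using tableau_inv[OF s(1) that] tableauD(1)[OF s(1)]
          by (smt (verit, best) inv_into_f_f mem_Collect_eq prod.collapse fst_conv)
        then show ?thesis using ab same by simp
      qed
      then have qT: "perm_tabloid ?q T = T"
        unfolding s(2) by (simp add: perm_tabloid_def tabloid_def transpose_image_eq)
      have g: "g T = 0" if "alternating la t g" for g
      proof -
        have "g T = of_int (sign ?q) * g T" using that q qT unfolding alternating_def by metis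
        then show ?thesis using ab(3) by (simp add: sign_swap_id)
      qed
      show ?thesis using g[OF f(2)] g[OF alternating_polytabloid] by simp
    qed
  qed
qed

text \<open>
  As \<open>f \<circ> p\<close> is the translate of \<open>f\<close> by the inverse of \<open>p\<close>, which has the same sign as \<open>p\<close>, this is the
  usual signed sum over the column stabilizer.
\<close>

definition column_antisymmetrizer ::
    "nat list \<Rightarrow> (nat \<times> nat \<Rightarrow> nat) \<Rightarrow> (nat set list \<Rightarrow> complex) \<Rightarrow> nat set list \<Rightarrow> complex"
  where "column_antisymmetrizer la t f =
    (\<lambda>T. \<Sum>p\<in>column_stabilizer la t. of_int (sign p) * f (perm_tabloid p T))"

lemma alternating_column_antisymmetrizer: "alternating la t (column_antisymmetrizer la t f)"
  unfolding alternating_def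
proof (intro ballI allI)
  fix q T assume q: "q \<in> column_stabilizer la t"
  have qp: "q permutes {1..sum_list la}" using q by (simp add: column_stabilizer_iff)
  note qq = permutes_inv_o[OF qp]
  show "column_antisymmetrizer la t f (perm_tabloid q T) =
      of_int (sign q) * column_antisymmetrizer la t f T"
    unfolding column_antisymmetrizer_def sum_distrib_left
  proof (rule sum.reindex_bij_witness[where i = "\<lambda>p. p \<circ> inv' q" and j = "\<lambda>p. p \<circ> q"])
    fix p assume p: "p \<in> column_stabilizer la t"
    show "p \<circ> inv' q \<circ> q = p" "p \<circ> q \<circ> inv' q = p"
      using qq by (simp_all add: comp_assoc)
    show "p \<circ> inv' q \<in> column_stabilizer la t" "p \<circ> q \<in> column_stabilizer la t"
      using p q by (simp_all add: column_stabilizer_comp column_stabilizer_inv)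
    have sg: "sign (p \<circ> q) = sign p * sign q"
      using column_stabilizer_permutation[OF p] column_stabilizer_permutation[OF q]
      by (simp add: sign_compose)
    have "sign q * (sign p * sign q) = sign p" by (simp add: sign_def)
    then have "of_int (sign q) * (of_int (sign p * sign q)) = (of_int (sign p) :: complex)"
      by (metis of_int_mult)
    then show "of_int (sign q) * (of_int (sign (p \<circ> q)) * f (perm_tabloid (p \<circ> q) T)) =
        of_int (sign p) * f (perm_tabloid p (perm_tabloid q T))"
      using sg by (simp add: perm_tabloid_comp mult.assoc[symmetric])
  qed
qed

text \<open>
  The antisymmetrizer is a combination of group elements.
\<close>

lemma column_antisymmetrizer_in_invariant_subspace:
  assumes U: "invariant_subspace (sym_group (sum_list la)) (tabloid_module la) U" and u: "u \<in> U"
  shows "column_antisymmetrizer la t u \<in> U"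
proof -
  let ?f = "\<lambda>c f T. c * f T :: complex"
  interpret vector_space ?f by (rule vector_space_fun)
  have sub: "subspace U" using U by (simp add: invariant_subspace_def rep_scale_tabloid_module)
  have "(\<lambda>T. u (perm_tabloid p T)) \<in> U" if p: "p \<in> column_stabilizer la t" for p
  proof -
    have pp: "p permutes {1..sum_list la}" using p by (simp add: column_stabilizer_iff)
    then have "rep_act (tabloid_module la) (inv' p) u \<in> U"
      using U u by (simp add: invariant_subspace_def sym_group_def permutes_inv)
    then show ?thesis using permutes_inv_inv[OF pp] by (simp add: rep_act_tabloid_module)
  qed
  then have "(\<Sum>p\<in>column_stabilizer la t. ?f (of_int (sign p)) (\<lambda>T. u (perm_tabloid p T))) \<in> U"
    by (intro subspace_sum[OF sub] subspace_scale[OF sub])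
  moreover have "(\<Sum>p\<in>column_stabilizer la t. ?f (of_int (sign p)) (\<lambda>T. u (perm_tabloid p T))) =
      column_antisymmetrizer la t u"
    by (simp add: fun_eq_iff sum_apply column_antisymmetrizer_def)
  ultimately show ?thesis by simp
qed

lemma rep_space_specht:
  "rep_space (specht la) = module.span (\<lambda>c f T. c * f T) {polytabloid la t |t. tableau la t}"
  by (simp add: specht_def rep_scale_tabloid_module)

lemma specht_induct [consumes 1, case_names zero add]:
  assumes "v \<in> rep_space (specht la)" "P 0"
    and "\<And>c t v. tableau la t \<Longrightarrow> P v \<Longrightarrow> P ((\<lambda>T. c * polytabloid la t T) + v)"
  shows "P v"
proof -
  interpret vector_space "\<lambda>c f T. c * f T :: complex" by (rule vector_space_fun)
  show ?thesis using assms(1) unfolding rep_space_specht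
  proof (rule span_induct_alt)
    fix c x y assume "x \<in> {polytabloid la t |t. tableau la t}" and y: "P y"
    then obtain t where t: "tableau la t" and x: "x = polytabloid la t" by blast
    show "P ((\<lambda>T. c * x T) + y)" unfolding x by (rule assms(3)[OF t y])
  qed (rule assms(2))
qed

lemma polytabloid_in_specht: "tableau la t \<Longrightarrow> polytabloid la t \<in> rep_space (specht la)"
proof -
  interpret vector_space "\<lambda>c f T. c * f T :: complex" by (rule vector_space_fun)
  show "tableau la t \<Longrightarrow> ?thesis" unfolding rep_space_specht by (rule span_base) blast
qed

lemma invariant_subspace_specht:
  "invariant_subspace (sym_group (sum_list la)) (tabloid_module la) (rep_space (specht la))"
proof -
  let ?M = "tabloid_module la" and ?S = "rep_space (specht la)"
  note rM = representation_tabloid_module[of la]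
  interpret vector_space "\<lambda>c f T. c * f T :: complex" by (rule vector_space_fun)
  have sub: "subspace ?S" unfolding rep_space_specht by (rule subspace_span)
  have subM: "?S \<subseteq> rep_space ?M"
    unfolding rep_space_specht
    by (rule span_minimal) (use polytabloid_in_module rM in \<open>auto simp: Defs.representation_def rep_scale_tabloid_module\<close>)
  show ?thesis
  proof (rule invariant_subspaceI[OF rM subM])
    fix p v assume p: "p \<in> carrier (sym_group (sum_list la))" and v: "v \<in> ?S"
    have pp: "p permutes {1..sum_list la}" using p by (simp add: sym_group_def)
    show "rep_act ?M p v \<in> ?S" using v
    proof (induction rule: specht_induct)
      case zero then show ?case unfolding rep_act_zero[OF rM p] by (rule subspace_0[OF sub])
    next
      case (add c t v)
      have "rep_act ?M p ((\<lambda>T. c * polytabloid la t T) + v) =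
          (\<lambda>T. c * rep_act ?M p (polytabloid la t) T) + rep_act ?M p v"
        by (simp add: rep_act_tabloid_module fun_eq_iff)
      also have "\<dots> \<in> ?S"
        unfolding polytabloid_act[OF pp]
        using add polytabloid_in_specht[OF tableau_comp[OF add(1) pp]]
        by (intro subspace_add[OF sub] subspace_scale[OF sub])
      finally show ?case .
    qed
  qed (use sub in \<open>simp_all add: rep_scale_tabloid_module subspace_0 subspace_add subspace_scale\<close>)
qed

lemma specht_eq: "specht la = (tabloid_module la)\<lparr>rep_space := rep_space (specht la)\<rparr>"
  by (simp add: specht_def)

lemma rep_scale_specht: "rep_scale (specht la) = (\<lambda>c f T. c * f T)"
  and rep_act_specht: "rep_act (specht la) = rep_act (tabloid_module la)"
  by (simp_all add: specht_def rep_scale_tabloid_module)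

lemma representation_specht: "representation (sym_group (sum_list la)) (specht la)"
  using subrepresentation[OF representation_tabloid_module invariant_subspace_specht] specht_eq
  by metis

text \<open>
  James's submodule theorem for an invariant subspace \<open>U\<close> of the Specht module. If some antisymmetrizer
  does not kill \<open>U\<close>, its image contains a multiple of a polytabloid, and \<open>U\<close> is everything. Otherwise
  \<open>U\<close> is orthogonal to all polytabloids, since \<open>\<langle>w, e\<^sub>t\<rangle>\<close> is the value at \<open>{t}\<close> of the antisymmetrized
  \<open>w\<close>; being contained in their span, \<open>U\<close> is zero because the Hermitian form is definite.
\<close>

theorem irreducible_specht:
  assumes sorted: "sorted_wrt (\<ge>) la"
  shows "irreducible_rep (sym_group (sum_list la)) (specht la)"
proof -
  let ?G = "sym_group (sum_list la)" and ?M = "tabloid_module la" and ?S = "rep_space (specht la)"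
  interpret vector_space "\<lambda>c f T. c * f T :: complex" by (rule vector_space_fun)
  have SM: "?S \<subseteq> rep_space ?M" using invariant_subspace_specht by (simp add: invariant_subspace_def)
  have "U = {0} \<or> U = ?S" if "invariant_subspace ?G (specht la) U" for U
  proof -
    have U: "invariant_subspace ?G ?M U" and US: "U \<subseteq> ?S"
      using that invariant_subspace_subrep[OF SM] specht_eq by metis+
    note u = invariant_subspaceD[OF representation_tabloid_module U]
    have sub: "subspace U" using U by (simp add: invariant_subspace_def rep_scale_tabloid_module)
    show ?thesis
    proof (cases "\<exists>t w. tableau la t \<and> w \<in> U \<and> column_antisymmetrizer la t w \<noteq> 0")
      case True
      then obtain t w where t: "tableau la t" "w \<in> U" and nz: "column_antisymmetrizer la t w \<noteq> 0" by blast
      let ?k = "column_antisymmetrizer la t w"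
      have kU: "?k \<in> U" by (rule column_antisymmetrizer_in_invariant_subspace[OF U t(2)])
      then obtain c where c: "?k = (\<lambda>T. c * polytabloid la t T)"
        using alternating_eq_multiple_polytabloid[OF sorted t(1) _ alternating_column_antisymmetrizer] u(1)
        by blast
      then have "c \<noteq> 0" using nz by (auto simp: fun_eq_iff)
      then have "polytabloid la t = (\<lambda>T. (1 / c) * ?k T)" using c by simp
      then have tU: "polytabloid la t \<in> U" using subspace_scale[OF sub kU, of "1 / c"] by simp
      have "polytabloid la s \<in> U" if s: "tableau la s" for s
      proof -
        obtain q where q: "q permutes {1..sum_list la}" "\<And>c. c \<in> cells la \<Longrightarrow> q (t c) = s c"
          using tableau_transitive[OF t(1) s] by blast
        have "polytabloid la s = polytabloid la (q \<circ> t)" by (rule polytabloid_cong) (simp add: q)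
        also have "\<dots> = rep_act ?M q (polytabloid la t)" using polytabloid_act[OF q(1)] by simp
        also have "\<dots> \<in> U" using u(5)[OF _ tU] q(1) by (simp add: sym_group_def)
        finally show ?thesis .
      qed
      then have "?S \<subseteq> U" unfolding rep_space_specht by (intro span_minimal[OF _ sub]) blast
      then show ?thesis using US by blast
    next
      case False
      have "w = 0" if w: "w \<in> U" for w
      proof -
        have wM: "w T = 0" if "T \<notin> tabloids la" for T
          using u(1) w that by (auto simp: rep_space_tabloid_module)
        have orth: "(\<Sum>T\<in>tabloids la. w T * cnj (polytabloid la t T)) = 0" if t: "tableau la t" for t
        proof -
          have "(\<Sum>T\<in>tabloids la. w T * cnj (polytabloid la t T)) =
              (\<Sum>T\<in>tabloids la. \<Sum>p\<in>column_stabilizer la t.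
                if T = perm_tabloid p (tabloid la t) then of_int (sign p) * w T else 0)"
            by (simp add: polytabloid_def sum_distrib_left mult.commute if_distrib cong: if_cong)
          also have "\<dots> = (\<Sum>p\<in>column_stabilizer la t. \<Sum>T\<in>tabloids la.
                if T = perm_tabloid p (tabloid la t) then of_int (sign p) * w T else 0)"
            by (rule sum.swap)
          also have "\<dots> = column_antisymmetrizer la t w (tabloid la t)"
            unfolding column_antisymmetrizer_def
            by (rule sum.cong)
              (use finite_tabloids perm_tabloid_in_tabloids[OF _ tabloid_in_tabloids[OF t]] in
                \<open>auto simp: sum.delta column_stabilizer_iff\<close>)
          also have "\<dots> = 0" using False w t by (metis zero_fun_apply)
          finally show ?thesis .
        qed
        have "(\<Sum>T\<in>tabloids la. w T * cnj (v T)) = 0" if "v \<in> ?S" for v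
          using that
        proof (induction rule: specht_induct)
          case zero then show ?case by simp
        next
          case (add c t v)
          have "(\<Sum>T\<in>tabloids la. w T * cnj (((\<lambda>T. c * polytabloid la t T) + v) T)) =
            cnj c * (\<Sum>T\<in>tabloids la. w T * cnj (polytabloid la t T)) + (\<Sum>T\<in>tabloids la. w T * cnj (v T))"
            by (simp add: algebra_simps sum.distrib sum_distrib_left)
          then show ?case using orth[OF add(1)] add(2) by simp
        qed
        then have "(\<Sum>T\<in>tabloids la. w T * cnj (w T)) = 0" using w US by blast
        moreover have "(\<Sum>T\<in>tabloids la. w T * cnj (w T)) = of_real (\<Sum>T\<in>tabloids la. (cmod (w T))\<^sup>2)"
          by (simp add: complex_norm_square del: of_real_power)
        ultimately have "of_real (\<Sum>T\<in>tabloids la. (cmod (w T))\<^sup>2) = (0::complex)" by metis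
        then have "(\<Sum>T\<in>tabloids la. (cmod (w T))\<^sup>2) = 0" by (simp only: of_real_eq_0_iff)
        then have "\<forall>T\<in>tabloids la. w T = 0" using finite_tabloids by (simp add: sum_nonneg_eq_0_iff)
        then show "w = 0" using wM by (auto simp: fun_eq_iff)
      qed
      then show ?thesis using u(2) by blast
    qed
  qed
  moreover have "?S \<noteq> {0}"
  proof -
    obtain t where t: "tableau la t" using tableau_exists by blast
    then have "polytabloid la t \<noteq> 0" using polytabloid_at_tabloid[OF t] by (metis zero_fun_apply zero_neq_one)
    then show ?thesis using polytabloid_in_specht[OF t] by blast
  qed
  ultimately show ?thesis using representation_specht by (simp add: irreducible_rep_def)
qed

text \<open>
  An endomorphism maps the alternating vector \<open>e\<^sub>t\<close> to an alternating vector, so it multiplies \<open>e\<^sub>t\<close> by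
  some \<open>c\<close>. The vectors that it multiplies by \<open>c\<close> form an invariant subspace.
\<close>

theorem specht_endomorphism_scalar:
  assumes sorted: "sorted_wrt (\<ge>) la"
    and f: "rep_hom (sym_group (sum_list la)) (specht la) (specht la) f"
  shows "\<exists>c. \<forall>v\<in>rep_space (specht la). f v = rep_scale (specht la) c v"
proof -
  let ?G = "sym_group (sum_list la)" and ?S = "rep_space (specht la)"
  note irr = irreducible_specht[OF sorted] and rS = representation_specht[of la]
  note cl = rep_space_closed[OF rS]
  obtain t where t: "tableau la t" using tableau_exists by blast
  let ?e = "polytabloid la t"
  have eS: "?e \<in> ?S" by (rule polytabloid_in_specht[OF t])
  have "alternating la t (f ?e)"
    unfolding alternating_def
  proof (intro ballI allI)
    fix q T assume q: "q \<in> column_stabilizer la t"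
    have qp: "q permutes {1..sum_list la}" using q by (simp add: column_stabilizer_iff)
    then have qi: "inv' q \<in> carrier ?G" by (simp add: sym_group_def permutes_inv)
    have act: "rep_act (specht la) (inv' q) h = (\<lambda>T. h (perm_tabloid q T))" for h
      using permutes_inv_inv[OF qp] by (simp add: rep_act_specht rep_act_tabloid_module)
    have "f ?e (perm_tabloid q T) = rep_act (specht la) (inv' q) (f ?e) T" by (simp add: act)
    also have "\<dots> = f (rep_act (specht la) (inv' q) ?e) T"
      using f qi eS by (simp add: rep_hom_def)
    also have "rep_act (specht la) (inv' q) ?e = rep_scale (specht la) (of_int (sign q)) ?e"
      using alternating_polytabloid q by (auto simp: act alternating_def rep_scale_specht)
    also have "f \<dots> T = of_int (sign q) * f ?e T"
      using f eS by (simp add: rep_hom_def rep_scale_specht)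
    finally show "f ?e (perm_tabloid q T) = of_int (sign q) * f ?e T" .
  qed
  moreover have "f ?e \<in> rep_space (tabloid_module la)"
    using f eS invariant_subspace_specht unfolding rep_hom_def invariant_subspace_def by blast
  ultimately obtain c where c: "f ?e = rep_scale (specht la) c ?e"
    using alternating_eq_multiple_polytabloid[OF sorted t] unfolding rep_scale_specht by blast
  let ?U = "{v \<in> ?S. f v = rep_scale (specht la) c v}"
  interpret vector_space "rep_scale (specht la)" using rS by (simp add: Defs.representation_def)
  have "invariant_subspace ?G (specht la) ?U"
  proof (rule invariant_subspaceI[OF rS])
    show "0 \<in> ?U" using cl(1) rep_hom_zero[OF rS f] by simp
    fix x y assume "x \<in> ?U" "y \<in> ?U"
    then show "x + y \<in> ?U" using cl(2) f unfolding rep_hom_def by (simp add: scale_right_distrib)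
  next
    fix a x assume "x \<in> ?U"
    then show "rep_scale (specht la) a x \<in> ?U"
      using cl(3) f unfolding rep_hom_def by (simp add: mult.commute)
  next
    fix g x assume g: "g \<in> carrier ?G" and x: "x \<in> ?U"
    have "f (rep_act (specht la) g x) = rep_act (specht la) g (rep_scale (specht la) c x)"
      using f g x unfolding rep_hom_def by simp
    also have "\<dots> = rep_scale (specht la) c (rep_act (specht la) g x)"
      using rS g x unfolding Defs.representation_def by blast
    finally show "rep_act (specht la) g x \<in> ?U" using cl(4)[OF g] x by simp
  qed blast
  moreover have "?U \<noteq> {0}"
    using eS c polytabloid_at_tabloid[OF t] by (metis (mono_tags, lifting) mem_Collect_eq singletonD zero_fun_apply zero_neq_one)
  ultimately have "?U = ?S" using irr unfolding irreducible_rep_def by blast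
  then show ?thesis by blast
qed


section \<open>Homomorphisms into representations induced from the trivial one\<close>

lemma unitary_function_rep_induced_trivial:
  assumes G: "group G" and fin: "finite (carrier G)" and H: "H \<subseteq> carrier G"
  shows "unitary_function_rep G (induced_rep G H trivial_rep) (carrier G)"
proof -
  interpret group G by (rule G)
  let ?V = "induced_rep G H trivial_rep"
  have scale: "rep_scale ?V = (\<lambda>c f x. c * f x)" by (simp add: induced_rep_def trivial_rep_def)
  have space: "rep_space ?V = {f. (\<forall>x. x \<notin> carrier G \<longrightarrow> f x = 0) \<and>
      (\<forall>h\<in>H. \<forall>x\<in>carrier G. f (h \<otimes>\<^bsub>G\<^esub> x) = f x)}"
    by (simp add: induced_rep_def trivial_rep_def)
  have act: "rep_act ?V g f = (\<lambda>x. if x \<in> carrier G then f (x \<otimes>\<^bsub>G\<^esub> g) else 0)" for g f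
    by (simp add: induced_rep_def)
  show ?thesis
  proof unfold_locales
    show "Defs.representation G ?V"
      unfolding representation_def scale space act subspace_iff[OF vector_space_fun]
      using H by (auto simp: vector_space_fun fun_eq_iff m_assoc subset_iff)
    fix g f f' assume g: "g \<in> carrier G"
    show "(\<Sum>x\<in>carrier G. rep_act ?V g f x * cnj (rep_act ?V g f' x)) =
        (\<Sum>x\<in>carrier G. f x * cnj (f' x))"
      by (rule sum.reindex_bij_witness[where i = "\<lambda>x. x \<otimes>\<^bsub>G\<^esub> inv\<^bsub>G\<^esub> g" and j = "\<lambda>x. x \<otimes>\<^bsub>G\<^esub> g"])
        (use g in \<open>auto simp: act m_assoc\<close>)
  qed (auto simp: scale space fin)
qed

text \<open>
  Frobenius reciprocity: an \<open>H\<close>-invariant linear functional \<open>v \<mapsto> (\<Sum>T. v T * a T)\<close> on the tabloid module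
  corresponds to the homomorphism into the induced representation that sends \<open>v\<close> to the values of the
  functional on the translates of \<open>v\<close>. Evaluation at the identity recovers the functional.
\<close>

definition frobenius_map ::
    "nat list \<Rightarrow> (nat set list \<Rightarrow> complex) \<Rightarrow> (nat set list \<Rightarrow> complex) \<Rightarrow> (nat \<Rightarrow> nat) \<Rightarrow> complex"
  where "frobenius_map la a v = (\<lambda>x. if x permutes {1..sum_list la}
    then \<Sum>T\<in>tabloids la. v T * a (perm_tabloid x T) else 0)"

lemma rep_hom_frobenius_map:
  fixes la :: "nat list"
  defines "G \<equiv> sym_group (sum_list la)"
  assumes H: "H \<subseteq> carrier G"
    and a: "\<And>h T. h \<in> H \<Longrightarrow> T \<in> tabloids la \<Longrightarrow> a (perm_tabloid h T) = a T"
  shows "rep_hom G (tabloid_module la) (induced_rep G H trivial_rep) (frobenius_map la a)"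
proof -
  have G: "carrier G = {p. p permutes {1..sum_list la}}" "\<And>p q. p \<otimes>\<^bsub>G\<^esub> q = p \<circ> q"
    by (simp_all add: G_def sym_group_def)
  have inv: "frobenius_map la a v (h \<circ> x) = frobenius_map la a v x"
    if h: "h \<in> H" and x: "x permutes {1..sum_list la}" for h x v
  proof -
    have hp: "h permutes {1..sum_list la}" using h H G by blast
    have "a (perm_tabloid (h \<circ> x) T) = a (perm_tabloid x T)" if T: "T \<in> tabloids la" for T
      using a[OF h perm_tabloid_in_tabloids[OF x T]] by (simp add: perm_tabloid_comp)
    then show ?thesis using hp x by (simp add: frobenius_map_def permutes_compose)
  qed
  have act: "frobenius_map la a (rep_act (tabloid_module la) g v) x = frobenius_map la a v (x \<circ> g)"
    if g: "g permutes {1..sum_list la}" and x: "x permutes {1..sum_list la}" for g x v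
  proof -
    have "(\<Sum>T\<in>tabloids la. v (perm_tabloid (inv' g) T) * a (perm_tabloid x T)) =
        (\<Sum>T\<in>tabloids la. v T * a (perm_tabloid (x \<circ> g) T))"
    proof (rule sum.reindex_bij_witness[where i = "perm_tabloid g" and j = "perm_tabloid (inv' g)"])
      fix T
      have "perm_tabloid (x \<circ> g) (perm_tabloid (inv' g) T) = perm_tabloid x T"
        using perm_tabloid_inv(1)[OF g] by (simp add: perm_tabloid_comp[symmetric])
      then show "v (perm_tabloid (inv' g) T) * a (perm_tabloid (x \<circ> g) (perm_tabloid (inv' g) T)) =
          v (perm_tabloid (inv' g) T) * a (perm_tabloid x T)" by simp
    qed (use perm_tabloid_inv[OF g] perm_tabloid_in_tabloids[OF g]
        perm_tabloid_in_tabloids[OF permutes_inv[OF g]] in auto)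
    then show ?thesis
      using g x by (simp add: frobenius_map_def rep_act_tabloid_module permutes_compose)
  qed
  show ?thesis unfolding rep_hom_def
  proof (intro conjI ballI allI)
    fix v show "frobenius_map la a v \<in> rep_space (induced_rep G H trivial_rep)"
      using inv by (auto simp: induced_rep_def trivial_rep_def G) (simp add: frobenius_map_def)
  next
    fix v w
    show "frobenius_map la a (v + w) = frobenius_map la a v + frobenius_map la a w"
      by (auto simp: frobenius_map_def fun_eq_iff algebra_simps sum.distrib)
  next
    fix c v
    show "frobenius_map la a (rep_scale (tabloid_module la) c v) =
        rep_scale (induced_rep G H trivial_rep) c (frobenius_map la a v)"
      by (auto simp: frobenius_map_def fun_eq_iff rep_scale_tabloid_module induced_rep_def
          trivial_rep_def sum_distrib_left mult.assoc)
  next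
    fix g v assume g: "g \<in> carrier G"
    show "frobenius_map la a (rep_act (tabloid_module la) g v) =
        rep_act (induced_rep G H trivial_rep) g (frobenius_map la a v)"
    proof
      fix x
      show "frobenius_map la a (rep_act (tabloid_module la) g v) x =
          rep_act (induced_rep G H trivial_rep) g (frobenius_map la a v) x"
      proof (cases "x permutes {1..sum_list la}")
        case True
        then show ?thesis using act g by (simp add: induced_rep_def G)
      next
        case False
        then show ?thesis by (simp add: frobenius_map_def induced_rep_def G)
      qed
    qed
  qed
qed

lemma rep_hom_restrict_specht:
  assumes "rep_hom (sym_group (sum_list la)) (tabloid_module la) V f"
  shows "rep_hom (sym_group (sum_list la)) (specht la) V f"
  using assms invariant_subspace_specht[of la]
  unfolding rep_hom_def invariant_subspace_def rep_act_specht rep_scale_specht rep_scale_tabloid_module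
  by (simp add: subset_iff)

lemma frobenius_map_polytabloid:
  assumes t: "tableau la t"
  shows "frobenius_map la a (polytabloid la t) id =
    (\<Sum>p\<in>column_stabilizer la t. of_int (sign p) * a (perm_tabloid p (tabloid la t)))"
proof -
  have "frobenius_map la a (polytabloid la t) id =
      (\<Sum>T\<in>tabloids la. \<Sum>p\<in>column_stabilizer la t.
        if T = perm_tabloid p (tabloid la t) then of_int (sign p) * a T else 0)"
    by (simp add: frobenius_map_def permutes_id polytabloid_def sum_distrib_right if_distrib
        if_distribR cong: if_cong)
  also have "\<dots> = (\<Sum>p\<in>column_stabilizer la t. \<Sum>T\<in>tabloids la.
        if T = perm_tabloid p (tabloid la t) then of_int (sign p) * a T else 0)"
    by (rule sum.swap)
  also have "\<dots> = (\<Sum>p\<in>column_stabilizer la t. of_int (sign p) * a (perm_tabloid p (tabloid la t)))"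
    by (rule sum.cong)
      (use finite_tabloids perm_tabloid_in_tabloids[OF _ tabloid_in_tabloids[OF t]] in
        \<open>auto simp: sum.delta column_stabilizer_iff\<close>)
  finally show ?thesis .
qed


section \<open>Invariant functionals for the wreath product\<close>

text \<open>
  The source of invariant functionals. Reading off in which rows of \<open>T\<close> the elements of each block lie
  yields a monomial in variables indexed by the possible patterns; \<open>w\<close> substitutes numbers for the
  variables, a pattern being given by how often it meets rows 1 and 2. Such products are
  blind to the order of the blocks and to the order within them.
\<close>

definition block_weight :: "nat \<Rightarrow> nat \<Rightarrow> (nat \<Rightarrow> nat \<Rightarrow> int) \<Rightarrow> nat set list \<Rightarrow> int"
  where "block_weight m n w T = (\<Prod>B\<in>blocks m n. w (card (B \<inter> T ! 1)) (card (B \<inter> T ! 2)))"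

lemma block_weight_wreath:
  assumes h: "h \<in> wreath m n" and T: "length T = 3"
  shows "block_weight m n w (perm_tabloid h T) = block_weight m n w T"
proof -
  have hp: "h permutes {1..m * n}" and hB: "(\<lambda>B. h ` B) ` blocks m n = blocks m n"
    using h by (auto simp: wreath_def sym_group_def)
  have inj: "inj h" using hp by (rule permutes_inj)
  have card: "card (h ` A \<inter> h ` B) = card (A \<inter> B)" for A B
    using inj by (metis card_image image_Int inj_on_subset subset_UNIV)
  have nth: "perm_tabloid h T ! i = h ` (T ! i)" if "i < 3" for i
    using that T by (simp add: perm_tabloid_def)
  have "block_weight m n w (perm_tabloid h T) =
      (\<Prod>B\<in>(\<lambda>B. h ` B) ` blocks m n. w (card (B \<inter> h ` (T ! 1))) (card (B \<inter> h ` (T ! 2))))"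
    unfolding block_weight_def hB by (simp add: nth)
  also have "\<dots> = (\<Prod>B\<in>blocks m n. w (card (h ` B \<inter> h ` (T ! 1))) (card (h ` B \<inter> h ` (T ! 2))))"
    using inj by (subst prod.reindex) (auto simp: inj_on_def inj_image_eq_iff)
  finally show ?thesis by (simp add: card block_weight_def)
qed

definition block_index :: "nat \<Rightarrow> nat" where "block_index x = (x - 1) div 3"

lemma card_block_Int:
  assumes "distinct xs" "0 \<notin> set xs"
  shows "card ({k * 3 + 1..(k + 1) * 3} \<inter> set xs) = count_list (map block_index xs) k"
  using assms
proof (induction xs)
  case Nil then show ?case by simp
next
  case (Cons x xs)
  have "x \<in> {k * 3 + 1..(k + 1) * 3} \<longleftrightarrow> block_index x = k"
    using Cons.prems by (auto simp: block_index_def)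
  then show ?case using Cons by (simp add: Int_insert_right)
qed

definition weight_product :: "(nat \<Rightarrow> nat \<Rightarrow> int) \<Rightarrow> nat list \<Rightarrow> nat list \<Rightarrow> int"
  where "weight_product w xs ys =
    prod_list (map (\<lambda>k. w (count_list (map block_index xs) k) (count_list (map block_index ys) k)) [0..<5])"

text \<open>
  Blocks that lie in row 0 contribute the factor 1. This makes the computation for \<open>n = 5\<close> valid for
  all larger \<open>n\<close>.
\<close>

lemma block_weight_eq_weight_product:
  assumes "n \<ge> 5" "w 0 0 = 1"
    and xs: "distinct xs" "set xs \<subseteq> {1..15}" "T ! 1 = set xs"
    and ys: "distinct ys" "set ys \<subseteq> {1..15}" "T ! 2 = set ys"
  shows "block_weight 3 n w T = weight_product w xs ys"
proof -
  let ?f = "\<lambda>k. w (count_list (map block_index xs) k) (count_list (map block_index ys) k)"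
  have inj: "inj_on (\<lambda>i. {i * 3 + 1..(i + 1) * 3}) {..<n}"
  proof (rule inj_onI)
    fix i j :: nat assume "{i * 3 + 1..(i + 1) * 3} = {j * 3 + 1..(j + 1) * 3}"
    then show "i = j" by (simp add: Icc_eq_Icc)
  qed
  have z: "0 \<notin> set xs" "0 \<notin> set ys" using xs(2) ys(2) by auto
  have "block_weight 3 n w T = (\<Prod>k<n. ?f k)"
    unfolding block_weight_def blocks_def xs(3) ys(3) prod.reindex[OF inj] o_def
      card_block_Int[OF xs(1) z(1)] card_block_Int[OF ys(1) z(2)] ..
  also have "\<dots> = (\<Prod>k<5. ?f k)"
  proof (rule prod.mono_neutral_right)
    have zero: "count_list (map block_index zs) k = 0" if "set zs \<subseteq> {1..15}" "k \<ge> 5" for zs k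
      using that by (force simp: count_list_0_iff block_index_def)
    show "\<forall>k\<in>{..<n} - {..<5}. ?f k = 1"
      using zero[OF xs(2)] zero[OF ys(2)] assms(2) by auto
  qed (use assms(1) in auto)
  also have "\<dots> = weight_product w xs ys"
    unfolding weight_product_def
    by (simp add: prod.list_conv_set_nth atLeast0LessThan)
  finally show ?thesis .
qed


section \<open>Signed sums over the column stabilizer\<close>

text \<open>
  For disjoint sets, these permutations form the direct product of the symmetric groups on the sets.
\<close>

definition stabilizer_of :: "'a set list \<Rightarrow> ('a \<Rightarrow> 'a) set"
  where "stabilizer_of As = {p. p permutes \<Union>(set As) \<and> (\<forall>A\<in>set As. p ` A = A)}"

lemma permutes_restrict:
  assumes "inj p" "p ` A = A"
  shows "(\<lambda>x. if x \<in> A then p x else x) permutes A"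
  by (rule bij_imp_permutes) (use assms in \<open>auto simp: bij_betw_def inj_on_def inj_def\<close>)

lemma sum_stabilizer_of_Cons:
  assumes disj: "A \<inter> \<Union>(set As) = {}"
  shows "(\<Sum>p\<in>stabilizer_of (A # As). f p) =
    (\<Sum>q | q permutes A. \<Sum>r\<in>stabilizer_of As. f (q \<circ> r))"
proof -
  let ?B = "\<Union>(set As)"
  have "(\<Sum>q | q permutes A. \<Sum>r\<in>stabilizer_of As. f (q \<circ> r)) =
      (\<Sum>(q, r)\<in>{q. q permutes A} \<times> stabilizer_of As. f (q \<circ> r))"
    by (rule sum.cartesian_product)
  also have "\<dots> = (\<Sum>p\<in>stabilizer_of (A # As). f p)"
  proof (rule sum.reindex_bij_witness[where j = "\<lambda>(q, r). q \<circ> r" and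
        i = "\<lambda>p. (\<lambda>x. if x \<in> A then p x else x, \<lambda>x. if x \<in> ?B then p x else x)"])
    fix z assume "z \<in> {q. q permutes A} \<times> stabilizer_of As"
    then obtain q r where z: "z = (q, r)" and q: "q permutes A" and r: "r permutes ?B"
      and rA: "\<And>A. A \<in> set As \<Longrightarrow> r ` A = A" by (auto simp: stabilizer_of_def)
    have rx: "r x = x" if "x \<in> A" for x using that disj permutes_not_in[OF r] by blast
    have qx: "q (r x) = r x" if "x \<in> ?B" for x
      using that disj permutes_not_in[OF q] permutes_in_image[OF r] by blast
    have out: "q (r x) = x" if "x \<notin> A" "x \<notin> ?B" for x
      using that permutes_not_in[OF q] permutes_not_in[OF r] by simp
    have "(\<lambda>x. if x \<in> A then (q \<circ> r) x else x) = q"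
      using rx permutes_not_in[OF q] by (auto simp: fun_eq_iff)
    moreover have "(\<lambda>x. if x \<in> ?B then (q \<circ> r) x else x) = r"
      using qx permutes_not_in[OF r] by (auto simp: fun_eq_iff)
    ultimately show "(\<lambda>p. (\<lambda>x. if x \<in> A then p x else x, \<lambda>x. if x \<in> ?B then p x else x))
        (case z of (q, r) \<Rightarrow> q \<circ> r) = z" unfolding z by (simp only: prod.case)
    have "q \<circ> r permutes A \<union> ?B"
      using permutes_subset[OF q] permutes_subset[OF r] by (intro permutes_compose) auto
    moreover have "(q \<circ> r) ` A = A" using rx permutes_image[OF q] by (auto simp: image_comp[symmetric])
    moreover have "(q \<circ> r) ` C = C" if "C \<in> set As" for C
    proof -
      have "(q \<circ> r) ` C = r ` C" using qx that by (intro image_cong) auto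
      then show ?thesis using rA[OF that] by simp
    qed
    ultimately show "(case z of (q, r) \<Rightarrow> q \<circ> r) \<in> stabilizer_of (A # As)"
      using z by (simp add: stabilizer_of_def)
  next
    fix p assume "p \<in> stabilizer_of (A # As)"
    then have p: "p permutes A \<union> ?B" "p ` A = A" "\<And>C. C \<in> set As \<Longrightarrow> p ` C = C"
      by (auto simp: stabilizer_of_def)
    have inj: "inj p" using p(1) by (rule permutes_inj)
    have pB: "p ` ?B = ?B" using p(3) by (auto simp: image_Union)
    show "(case (\<lambda>x. if x \<in> A then p x else x, \<lambda>x. if x \<in> ?B then p x else x) of (q, r) \<Rightarrow> q \<circ> r) = p"
    proof
      fix x
      have "p x \<notin> A" if "x \<in> ?B" using that pB disj by blast
      then show "(case (\<lambda>x. if x \<in> A then p x else x, \<lambda>x. if x \<in> ?B then p x else x) of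
          (q, r) \<Rightarrow> q \<circ> r) x = p x"
        using permutes_not_in[OF p(1), of x] disj by auto
    qed
    have "(\<lambda>x. if x \<in> ?B then p x else x) ` C = C" if "C \<in> set As" for C
    proof -
      have "(\<lambda>x. if x \<in> ?B then p x else x) ` C = p ` C" using that by (intro image_cong) auto
      then show ?thesis using p(3)[OF that] by simp
    qed
    then show "(\<lambda>x. if x \<in> A then p x else x, \<lambda>x. if x \<in> ?B then p x else x) \<in>
        {q. q permutes A} \<times> stabilizer_of As"
      using permutes_restrict[OF inj p(2)] permutes_restrict[OF inj pB] by (simp add: stabilizer_of_def)
  qed auto
  finally show ?thesis by simp
qed

text \<open>
  Sums over the symmetric groups of degree 2 and 3 with signs, written out so that they can be evaluated.
\<close>

definition alt2 :: "('a \<Rightarrow> 'a \<Rightarrow> int) \<Rightarrow> 'a \<Rightarrow> 'a \<Rightarrow> int"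
  where "alt2 F a b = F a b - F b a"

definition alt3 :: "('a \<Rightarrow> 'a \<Rightarrow> 'a \<Rightarrow> int) \<Rightarrow> 'a \<Rightarrow> 'a \<Rightarrow> 'a \<Rightarrow> int"
  where "alt3 F a b c = F a b c - F b a c - F c b a - F a c b + F b c a + F c a b"

lemma sum_permutations_2:
  assumes "a \<noteq> b"
  shows "(\<Sum>q | q permutes {a, b}. sign q * F (q a) (q b)) = alt2 F a b"
  using assms
  by (simp add: sum_over_permutations_insert sign_compose sign_swap_id permutation_swap_id
      alt2_def transpose_def cong: if_cong)

lemma sum_permutations_3:
  assumes "a \<noteq> b" "a \<noteq> c" "b \<noteq> c"
  shows "(\<Sum>q | q permutes {a, b, c}. sign q * F (q a) (q b) (q c)) = alt3 F a b c"
  using assms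
  by (simp add: sum_over_permutations_insert sign_compose sign_swap_id permutation_swap_id
      permutation_compose alt3_def transpose_def cong: if_cong)

lemma column_disjoint:
  assumes "tableau la t" "i \<noteq> j"
  shows "column la t i \<inter> column la t j = {}"
proof -
  have False if "x \<in> column la t i" "x \<in> column la t j" for x
  proof -
    from that obtain k l where "(k, i) \<in> cells la" "(l, j) \<in> cells la" "t (k, i) = t (l, j)"
      unfolding column_def by force
    then show False using inj_onD[OF tableauD(1)[OF assms(1)]] assms(2) by blast
  qed
  then show ?thesis by blast
qed

text \<open>
  Only the columns with more than one entry matter, and their number does not grow with the first row.
\<close>

lemma column_stabilizer_eq_stabilizer_of:
  assumes t: "tableau la t" and single: "\<And>i j. (i, j) \<in> cells la \<Longrightarrow> k \<le> j \<Longrightarrow> i = 0"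
  shows "column_stabilizer la t = stabilizer_of (map (column la t) [0..<k])"
proof -
  let ?U = "\<Union>(set (map (column la t) [0..<k]))"
  have col: "x \<in> {1..sum_list la}" if x: "x \<in> column la t j" for x j
  proof -
    obtain i where "(i, j) \<in> cells la" "x = t (i, j)" using x by (auto simp: column_def)
    then show ?thesis using tableauD(2)[OF t] by blast
  qed
  have fixed: "p ` column la t j = column la t j" if "p permutes ?U" "k \<le> j" for p j
  proof -
    have "x \<notin> ?U" if "x \<in> column la t j" for x
    proof
      assume "x \<in> ?U"
      then obtain i where "i < k" "x \<in> column la t i" by auto
      then show False using column_disjoint[OF t, of i j] that \<open>k \<le> j\<close> by auto
    qed
    then have "p x = x" if "x \<in> column la t j" for x
      using that permutes_not_in[OF \<open>p permutes ?U\<close>] by blast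
    then show ?thesis by simp
  qed
  have restrict: "p permutes ?U" if p: "p permutes {1..sum_list la}"
    and pc: "\<And>j. p ` column la t j = column la t j" for p
  proof (rule permutes_superset[OF p])
    fix x assume x: "x \<in> {1..sum_list la} - ?U"
    then obtain i j where ij: "(i, j) \<in> cells la" "x = t (i, j)"
      using tableauD(2)[OF t] by (metis DiffD1 imageE surj_pair)
    have xc: "x \<in> column la t j" using ij by (auto simp: column_def)
    then have "k \<le> j" using x by force
    then have "y = x" if "y \<in> column la t j" for y
      using that ij single by (auto simp: column_def)
    then show "p x = x" using pc[of j] xc by blast
  qed
  have U: "?U \<subseteq> {1..sum_list la}" using col by auto
  show ?thesis
  proof (intro equalityI subsetI)
    fix p assume "p \<in> column_stabilizer la t"
    then have p: "p permutes {1..sum_list la}" "\<And>j. p ` column la t j = column la t j"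
      by (auto simp: column_stabilizer_iff)
    show "p \<in> stabilizer_of (map (column la t) [0..<k])"
      using restrict[OF p] p(2) unfolding stabilizer_of_def by auto
  next
    fix p assume "p \<in> stabilizer_of (map (column la t) [0..<k])"
    then have p: "p permutes ?U" and pc: "\<And>j. j < k \<Longrightarrow> p ` column la t j = column la t j"
      unfolding stabilizer_of_def by auto
    have "p ` column la t j = column la t j" for j
      using pc fixed[OF p] by (cases "j < k") auto
    then show "p \<in> column_stabilizer la t"
      using permutes_subset[OF p U] unfolding column_stabilizer_iff by blast
  qed
qed

lemma cells_3_rows:
  "(i, j) \<in> cells [r, 4, 2] \<longleftrightarrow> i = 0 \<and> j < r \<or> i = 1 \<and> j < 4 \<or> i = 2 \<and> j < 2"
  by (auto simp: cells_def nth_Cons' less_Suc_eq)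

text \<open>
  A column permutation moves the entries of rows 1 and 2 independently in each of the four columns
  that have more than one entry, of heights 3, 3, 2 and 2. The summation variables \<open>a\<close>, \<open>b\<close>, \<open>c\<close>, \<open>d\<close>
  stand for the permuted entries of these columns, indexed by row.
\<close>

lemma signed_sum_column_stabilizer:
  fixes \<Phi> :: "nat \<Rightarrow> nat \<Rightarrow> nat \<Rightarrow> nat \<Rightarrow> nat \<Rightarrow> nat \<Rightarrow> int"
  assumes t: "tableau [r, 4, 2] t" and r: "4 \<le> r"
  shows "(\<Sum>p\<in>column_stabilizer [r, 4, 2] t. sign p *
      \<Phi> (p (t (1, 0))) (p (t (1, 1))) (p (t (1, 2))) (p (t (1, 3))) (p (t (2, 0))) (p (t (2, 1)))) =
    alt3 (\<lambda>a0 a1 a2. alt3 (\<lambda>b0 b1 b2. alt2 (\<lambda>c0 c1. alt2 (\<lambda>d0 d1. \<Phi> a1 b1 c1 d1 a2 b2)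
      (t (0, 3)) (t (1, 3))) (t (0, 2)) (t (1, 2)))
      (t (0, 1)) (t (1, 1)) (t (2, 1))) (t (0, 0)) (t (1, 0)) (t (2, 0))"
proof -
  let ?la = "[r, 4, 2]"
  let ?col = "column ?la t"
  have A: "?col 0 = {t (0, 0), t (1, 0), t (2, 0)}" "?col 1 = {t (0, 1), t (1, 1), t (2, 1)}"
    "?col 2 = {t (0, 2), t (1, 2)}" "?col 3 = {t (0, 3), t (1, 3)}"
    using r by (auto simp: column_def cells_3_rows)
  have neq: "t (i, j) \<noteq> t (i', j)" if "(i, j) \<in> cells ?la" "(i', j) \<in> cells ?la" "i \<noteq> i'" for i i' j
    using inj_onD[OF tableauD(1)[OF t]] that by blast
  have stab: "column_stabilizer ?la t = stabilizer_of [?col 0, ?col 1, ?col 2, ?col 3]"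
  proof -
    have "column_stabilizer ?la t = stabilizer_of (map ?col [0..<4])"
      by (rule column_stabilizer_eq_stabilizer_of[OF t]) (auto simp: cells_3_rows)
    then show ?thesis by (simp add: upt_rec numeral_eq_Suc)
  qed
  note disj = column_disjoint[OF t]
  have fin: "finite (?col j)" for j
    using finite_cells by (rule finite_subset[rotated, OF finite_imageI[of _ t]]) (auto simp: column_def)
  let ?S = "\<lambda>j. {q. q permutes ?col j}"
  have id: "stabilizer_of [] = {id}" by (auto simp: stabilizer_of_def permutes_id)
  have "(\<Sum>p\<in>column_stabilizer ?la t. sign p *
      \<Phi> (p (t (1, 0))) (p (t (1, 1))) (p (t (1, 2))) (p (t (1, 3))) (p (t (2, 0))) (p (t (2, 1)))) =
    (\<Sum>q0\<in>?S 0. \<Sum>q1\<in>?S 1. \<Sum>q2\<in>?S 2. \<Sum>q3\<in>?S 3. let p = q0 \<circ> (q1 \<circ> (q2 \<circ> q3)) in sign p *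
      \<Phi> (p (t (1, 0))) (p (t (1, 1))) (p (t (1, 2))) (p (t (1, 3))) (p (t (2, 0))) (p (t (2, 1))))"
  proof -
    have D: "?col 0 \<inter> \<Union>(set [?col 1, ?col 2, ?col 3]) = {}"
      "?col 1 \<inter> \<Union>(set [?col 2, ?col 3]) = {}" "?col 2 \<inter> \<Union>(set [?col 3]) = {}"
      "?col 3 \<inter> \<Union>(set []) = {}"
      using disj by (simp_all add: Int_Un_distrib)
    show ?thesis
      unfolding stab Let_def sum_stabilizer_of_Cons[OF D(1)] sum_stabilizer_of_Cons[OF D(2)]
        sum_stabilizer_of_Cons[OF D(3)] sum_stabilizer_of_Cons[OF D(4)] id by simp
  qed
  also have "\<dots> = (\<Sum>q0\<in>?S 0. \<Sum>q1\<in>?S 1. \<Sum>q2\<in>?S 2. \<Sum>q3\<in>?S 3. sign q0 * (sign q1 * (sign q2 * (sign q3 *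
      \<Phi> (q0 (t (1, 0))) (q1 (t (1, 1))) (q2 (t (1, 2))) (q3 (t (1, 3))) (q0 (t (2, 0))) (q1 (t (2, 1)))))))"
  proof (intro sum.cong refl)
    fix q0 q1 q2 q3
    assume "q0 \<in> ?S 0" "q1 \<in> ?S 1" "q2 \<in> ?S 2" "q3 \<in> ?S 3"
    then have q: "q0 permutes ?col 0" "q1 permutes ?col 1" "q2 permutes ?col 2" "q3 permutes ?col 3"
      by simp_all
    have perm: "permutation q0" "permutation q1" "permutation q2" "permutation q3"
      using q fin by (auto simp: permutation_permutes)
    let ?p = "q0 \<circ> (q1 \<circ> (q2 \<circ> q3))"
    have sgn: "sign ?p = sign q0 * (sign q1 * (sign q2 * sign q3))"
      using perm by (simp add: sign_compose permutation_compose)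
    have other: "q x = x" if "q permutes ?col i" "x \<in> ?col j" "i \<noteq> j" for q x i j
      using that disj[of i j] permutes_not_in[OF that(1)] by blast
    have p0: "?p x = q0 x" if "x \<in> ?col 0" for x
      using that other[OF q(2)] other[OF q(3)] other[OF q(4)] by simp
    have p1: "?p x = q1 x" if "x \<in> ?col 1" for x
      using that other[OF q(1), of "q1 x" 1] other[OF q(3), of x 1] other[OF q(4), of x 1]
        permutes_in_image[OF q(2)] by simp
    have p2: "?p x = q2 x" if "x \<in> ?col 2" for x
      using that other[OF q(1), of "q2 x" 2] other[OF q(2), of "q2 x" 2] other[OF q(4), of x 2]
        permutes_in_image[OF q(3)] by simp
    have p3: "?p x = q3 x" if "x \<in> ?col 3" for x
      using that other[OF q(1), of "q3 x" 3] other[OF q(2), of "q3 x" 3] other[OF q(3), of "q3 x" 3]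
        permutes_in_image[OF q(4)] by simp
    have "t (1, 0) \<in> ?col 0" "t (2, 0) \<in> ?col 0" "t (1, 1) \<in> ?col 1" "t (2, 1) \<in> ?col 1"
      "t (1, 2) \<in> ?col 2" "t (1, 3) \<in> ?col 3"
      unfolding A by simp_all
    note p = p0[OF this(1)] p0[OF this(2)] p1[OF this(3)] p1[OF this(4)] p2[OF this(5)] p3[OF this(6)]
    show "(let p = ?p in sign p *
        \<Phi> (p (t (1, 0))) (p (t (1, 1))) (p (t (1, 2))) (p (t (1, 3))) (p (t (2, 0))) (p (t (2, 1)))) =
      sign q0 * (sign q1 * (sign q2 * (sign q3 *
        \<Phi> (q0 (t (1, 0))) (q1 (t (1, 1))) (q2 (t (1, 2))) (q3 (t (1, 3))) (q0 (t (2, 0))) (q1 (t (2, 1))))))"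
      unfolding Let_def sgn p by (simp only: mult.assoc)
  qed
  also have "\<dots> = (\<Sum>q0\<in>?S 0. sign q0 * (\<Sum>q1\<in>?S 1. sign q1 * (\<Sum>q2\<in>?S 2. sign q2 * (\<Sum>q3\<in>?S 3. sign q3 *
      \<Phi> (q0 (t (1, 0))) (q1 (t (1, 1))) (q2 (t (1, 2))) (q3 (t (1, 3))) (q0 (t (2, 0))) (q1 (t (2, 1)))))))"
    by (simp only: sum_distrib_left)
  also have "\<dots> = alt3 (\<lambda>a0 a1 a2. alt3 (\<lambda>b0 b1 b2. alt2 (\<lambda>c0 c1. alt2 (\<lambda>d0 d1. \<Phi> a1 b1 c1 d1 a2 b2)
      (t (0, 3)) (t (1, 3))) (t (0, 2)) (t (1, 2)))
      (t (0, 1)) (t (1, 1)) (t (2, 1))) (t (0, 0)) (t (1, 0)) (t (2, 0))"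
  proof -
    let ?D = "\<lambda>F. alt2 (\<lambda>d0 d1. F d1) (t (0, 3)) (t (1, 3))"
    let ?C = "\<lambda>F. alt2 (\<lambda>c0 c1. F c1) (t (0, 2)) (t (1, 2))"
    let ?B = "\<lambda>F. alt3 (\<lambda>b0 b1 b2. F b1 b2) (t (0, 1)) (t (1, 1)) (t (2, 1))"
    let ?A = "\<lambda>F. alt3 (\<lambda>a0 a1 a2. F a1 a2) (t (0, 0)) (t (1, 0)) (t (2, 0))"
    have ne: "t (0, 3) \<noteq> t (1, 3)" "t (0, 2) \<noteq> t (1, 2)"
      "t (0, 1) \<noteq> t (1, 1)" "t (0, 1) \<noteq> t (2, 1)" "t (1, 1) \<noteq> t (2, 1)"
      "t (0, 0) \<noteq> t (1, 0)" "t (0, 0) \<noteq> t (2, 0)" "t (1, 0) \<noteq> t (2, 0)"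
      using r by (simp_all add: neq cells_3_rows)
    have D: "(\<Sum>q\<in>?S 3. sign q * F (q (t (1, 3)))) = ?D F" for F
      unfolding A by (rule sum_permutations_2[of _ _ "\<lambda>_. F"]) (fact ne)+
    have C: "(\<Sum>q\<in>?S 2. sign q * F (q (t (1, 2)))) = ?C F" for F
      unfolding A by (rule sum_permutations_2[of _ _ "\<lambda>_. F"]) (fact ne)+
    have B: "(\<Sum>q\<in>?S 1. sign q * F (q (t (1, 1))) (q (t (2, 1)))) = ?B F" for F
      unfolding A by (rule sum_permutations_3[of _ _ _ "\<lambda>_. F"]) (fact ne)+
    have A: "(\<Sum>q\<in>?S 0. sign q * F (q (t (1, 0))) (q (t (2, 0)))) = ?A F" for F
      unfolding A by (rule sum_permutations_3[of _ _ _ "\<lambda>_. F"]) (fact ne)+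
    show ?thesis
      unfolding D[of "\<lambda>d1. \<Phi> _ _ _ d1 _ _"] C[of "\<lambda>c1. ?D (\<lambda>d1. \<Phi> _ _ c1 d1 _ _)"]
        B[of "\<lambda>b1 b2. ?C (\<lambda>c1. ?D (\<lambda>d1. \<Phi> _ b1 c1 d1 _ b2))"]
        A[of "\<lambda>a1 a2. ?B (\<lambda>b1 b2. ?C (\<lambda>c1. ?D (\<lambda>d1. \<Phi> a1 b1 c1 d1 a2 b2)))"] ..
  qed
  finally show ?thesis .
qed


section \<open>Two independent functionals for the shape (3n - 6, 4, 2)\<close>

definition alternating_weight :: "(nat \<Rightarrow> nat \<Rightarrow> int) \<Rightarrow> (nat \<times> nat \<Rightarrow> nat) \<Rightarrow> int"
  where "alternating_weight w t =
    alt3 (\<lambda>a0 a1 a2. alt3 (\<lambda>b0 b1 b2. alt2 (\<lambda>c0 c1. alt2 (\<lambda>d0 d1.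
        weight_product w [a1, b1, c1, d1] [a2, b2])
      (t (0, 3)) (t (1, 3))) (t (0, 2)) (t (1, 2)))
      (t (0, 1)) (t (1, 1)) (t (2, 1))) (t (0, 0)) (t (1, 0)) (t (2, 0))"

lemma signed_sum_block_weight:
  assumes n: "n \<ge> 5" and w: "w 0 0 = 1" and r: "4 \<le> r" and t: "tableau [r, 4, 2] t"
    and small: "\<And>i j. (i, j) \<in> cells [r, 4, 2] \<Longrightarrow> j < 4 \<Longrightarrow> t (i, j) \<le> 15"
  shows "(\<Sum>p\<in>column_stabilizer [r, 4, 2] t. sign p * block_weight 3 n w (perm_tabloid p (tabloid [r, 4, 2] t))) =
    alternating_weight w t"
proof -
  let ?la = "[r, 4, 2]"
  have "block_weight 3 n w (perm_tabloid p (tabloid ?la t)) =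
      weight_product w [p (t (1, 0)), p (t (1, 1)), p (t (1, 2)), p (t (1, 3))] [p (t (2, 0)), p (t (2, 1))]"
    if p: "p \<in> column_stabilizer ?la t" for p
  proof (rule block_weight_eq_weight_product[where n = n and w = w, OF n w])
    have pp: "p permutes {1..sum_list ?la}" and pc: "\<And>j. p ` column ?la t j = column ?la t j"
      using p by (auto simp: column_stabilizer_iff)
    have neq: "p (t c) \<noteq> p (t c')" if "c \<in> cells ?la" "c' \<in> cells ?la" "c \<noteq> c'" for c c'
      using that inj_onD[OF tableauD(1)[OF t]] permutes_inj[OF pp] by (metis injD)
    have range: "p (t (i, j)) \<in> {1..15}" if ij: "(i, j) \<in> cells ?la" "j < 4" for i j
    proof -
      have "p (t (i, j)) \<in> p ` column ?la t j" using ij by (auto simp: column_def)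
      then obtain i' where "(i', j) \<in> cells ?la" "p (t (i, j)) = t (i', j)"
        unfolding pc by (auto simp: column_def)
      moreover from this have "t (i', j) \<in> {1..sum_list ?la}" using tableauD(2)[OF t] by blast
      ultimately show ?thesis using small[of i' j] ij(2) by auto
    qed
    show "distinct [p (t (1, 0)), p (t (1, 1)), p (t (1, 2)), p (t (1, 3))]"
      "distinct [p (t (2, 0)), p (t (2, 1))]"
      using neq[of "(1, 0)" "(1, 1)"] neq[of "(1, 0)" "(1, 2)"] neq[of "(1, 0)" "(1, 3)"]
        neq[of "(1, 1)" "(1, 2)"] neq[of "(1, 1)" "(1, 3)"] neq[of "(1, 2)" "(1, 3)"]
        neq[of "(2, 0)" "(2, 1)"]
      by (simp_all add: cells_3_rows)
    show "set [p (t (1, 0)), p (t (1, 1)), p (t (1, 2)), p (t (1, 3))] \<subseteq> {1..15}"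
      "set [p (t (2, 0)), p (t (2, 1))] \<subseteq> {1..15}"
      using range[of 1 0] range[of 1 1] range[of 1 2] range[of 1 3] range[of 2 0] range[of 2 1]
      by (simp_all add: cells_3_rows)
    have row: "perm_tabloid p (tabloid ?la t) ! i = p ` {t (i, j) |j. (i, j) \<in> cells ?la}" if "i < 3" for i
      using that by (simp add: perm_tabloid_def tabloid_def del: upt_Suc)
    have rows: "{t (1, j) |j. (1, j) \<in> cells ?la} = {t (1, 0), t (1, 1), t (1, 2), t (1, 3)}"
      "{t (2, j) |j. (2, j) \<in> cells ?la} = {t (2, 0), t (2, 1)}"
    proof -
      have "(1, j) \<in> cells ?la \<longleftrightarrow> j \<in> {0, 1, 2, 3}" "(2, j) \<in> cells ?la \<longleftrightarrow> j \<in> {0, 1}" for j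
        by (auto simp: cells_3_rows)
      then show "{t (1, j) |j. (1, j) \<in> cells ?la} = {t (1, 0), t (1, 1), t (1, 2), t (1, 3)}"
        "{t (2, j) |j. (2, j) \<in> cells ?la} = {t (2, 0), t (2, 1)}"
        by auto
    qed
    show "perm_tabloid p (tabloid ?la t) ! 1 = set [p (t (1, 0)), p (t (1, 1)), p (t (1, 2)), p (t (1, 3))]"
      using row[of 1] rows(1) by simp
    show "perm_tabloid p (tabloid ?la t) ! 2 = set [p (t (2, 0)), p (t (2, 1))]"
      using row[of 2] rows(2) by simp
  qed
  then show ?thesis using signed_sum_column_stabilizer[OF t r]
    by (simp add: alternating_weight_def)
qed

text \<open>
  Tableaux whose cells in the diagram of \<open>(9, 4, 2)\<close> hold \<open>1, \<dots>, 15\<close>. The entry \<open>j + 7\<close> continues row 0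
  with 16 in column 9, so that the blocks beyond the fifth lie in row 0.
\<close>

definition filling :: "nat list \<Rightarrow> nat list \<Rightarrow> nat list \<Rightarrow> nat \<times> nat \<Rightarrow> nat"
  where "filling R0 R1 R2 = (\<lambda>(i, j). if i = 0 then (if j < 9 then R0 ! j else j + 7)
    else if i = 1 then R1 ! j else R2 ! j)"

lemma tableau_filling:
  assumes n: "n \<ge> 5" and len: "length R0 = 9" "length R1 = 4" "length R2 = 2"
    and set: "set (R0 @ R1 @ R2) = {1..15}"
  shows "tableau [3 * n - 6, 4, 2] (filling R0 R1 R2)"
proof -
  let ?la = "[3 * n - 6, 4, 2]" and ?t = "filling R0 R1 R2"
  have sum: "sum_list ?la = 3 * n" using n by simp
  have img: "?t ` cells ?la = {1..3 * n}"
  proof (intro equalityI subsetI)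
    fix x assume "x \<in> ?t ` cells ?la"
    then obtain i j where ij: "(i, j) \<in> cells ?la" "x = ?t (i, j)" by force
    then have "x \<in> set (R0 @ R1 @ R2) \<or> x = j + 7 \<and> 9 \<le> j \<and> j < 3 * n - 6"
      by (auto simp: cells_3_rows filling_def len)
    then show "x \<in> {1..3 * n}" unfolding set using n by auto
  next
    fix x assume x: "x \<in> {1..3 * n}"
    show "x \<in> ?t ` cells ?la"
    proof (cases "x \<le> 15")
      case True
      then have "x \<in> set (R0 @ R1 @ R2)" using x set by simp
      then consider j where "j < 9" "x = R0 ! j" | j where "j < 4" "x = R1 ! j" | j where "j < 2" "x = R2 ! j"
        using len by (auto simp: in_set_conv_nth)
      then show ?thesis
      proof cases
        case 1 then show ?thesis using n by (intro image_eqI[of _ _ "(0, j)"]) (auto simp: filling_def cells_3_rows)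
      next
        case 2 then show ?thesis by (intro image_eqI[of _ _ "(1, j)"]) (auto simp: filling_def cells_3_rows)
      next
        case 3 then show ?thesis by (intro image_eqI[of _ _ "(2, j)"]) (auto simp: filling_def cells_3_rows)
      qed
    next
      case False
      then show ?thesis using x by (intro image_eqI[of _ _ "(0, x - 7)"]) (auto simp: filling_def cells_3_rows)
    qed
  qed
  have "inj_on ?t (cells ?la)"
    by (rule eq_card_imp_inj_on[OF finite_cells]) (simp only: img card_cells sum, simp)
  then show ?thesis unfolding tableau_def bij_betw_def sum using img by blast
qed

text \<open>
  The two functionals and the two polytabloids on which they are evaluated. A functional that is
  supported on few patterns keeps few of the 144 terms of a polytabloid. The first one retains two
  blocks that each have two elements in row 1 and one in row 2, the other elements lying in row 0. For
  \<open>filling2\<close> this never occurs, as counting from 0, its columns 2 and 3 meet only blocks 3 and 4, which its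
  columns 0 and 1 avoid; the resulting matrix of values is triangular with nonzero diagonal.
\<close>

definition weight1 :: "nat \<Rightarrow> nat \<Rightarrow> int"
  where "weight1 k l = (if k = 0 \<and> l = 0 \<or> k = 2 \<and> l = 1 then 1 else 0)"

definition weight2 :: "nat \<Rightarrow> nat \<Rightarrow> int"
  where "weight2 k l = (if k = 0 \<and> l = 0 \<or> k = 2 \<and> l = 0 \<or> k = 0 \<and> l = 2 then 1 else 0)"

definition filling1 :: "nat \<times> nat \<Rightarrow> nat"
  where "filling1 = filling [1, 2, 3, 6, 9, 12, 13, 14, 15] [4, 5, 10, 11] [7, 8]"

definition filling2 :: "nat \<times> nat \<Rightarrow> nat"
  where "filling2 = filling [1, 2, 10, 11, 3, 6, 9, 12, 15] [4, 5, 13, 14] [7, 8]"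

lemma alternating_weight_values:
  "alternating_weight weight1 filling1 = - 2" "alternating_weight weight1 filling2 = 0"
  "alternating_weight weight2 filling2 = 12"
  by code_simp+

lemma filling_le_15:
  assumes len: "length R0 = 9" "length R1 = 4" "length R2 = 2"
    and set: "set (R0 @ R1 @ R2) = {1..15}"
    and ij: "(i, j) \<in> cells [r, 4, 2]" "j < 4"
  shows "filling R0 R1 R2 (i, j) \<le> 15"
proof -
  have "filling R0 R1 R2 (i, j) \<in> set (R0 @ R1 @ R2)"
    using ij len by (auto simp: filling_def cells_3_rows)
  then show ?thesis unfolding set by simp
qed

theorem theorem4p2:
  fixes n :: nat
  assumes "n \<ge> 5"
  defines "G \<equiv> sym_group (3 * n)"
  defines "V \<equiv> induced_rep G (wreath 3 n) trivial_rep"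
  shows "\<not> multiplicity_free G V \<and>
         (\<exists>la. partition_of (3 * n) la \<and> rep_multiplicity G (specht la) V \<ge> 2)"
proof -
  define la where "la = [3 * n - 6, 4, 2]"
  have sum: "sum_list la = 3 * n" and sorted: "sorted_wrt (\<ge>) la" and part: "partition_of (3 * n) la"
    using assms(1) by (auto simp: la_def partition_of_def)
  have G: "G = sym_group (sum_list la)" by (simp add: G_def sum)
  have sub: "wreath 3 n \<subseteq> carrier G" by (auto simp: wreath_def G_def)
  have fin: "finite (carrier G)" by (simp add: G_def sym_group_def finite_permutations)
  interpret V: unitary_function_rep G V "carrier G"
    unfolding V_def by (rule unitary_function_rep_induced_trivial[OF _ fin sub])
      (simp add: G_def sym_group_is_group)
  \<comment> \<open>By Frobenius reciprocity, every weight gives a homomorphism from the Specht module to \<open>V\<close>.\<close>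
  define F where "F w = frobenius_map la (\<lambda>T. of_int (block_weight 3 n w T))" for w
  have len: "length T = 3" if "T \<in> tabloids la" for T
    using that by (auto simp: tabloids_def tabloid_def la_def)
  have hom: "rep_hom G (specht la) V (F w)" for w
    unfolding V_def G F_def
    by (rule rep_hom_restrict_specht, rule rep_hom_frobenius_map)
      (use sub block_weight_wreath len in \<open>simp_all add: G\<close>)
  have t: "tableau la filling1" "tableau la filling2"
    unfolding la_def filling1_def filling2_def
    by (rule tableau_filling[OF assms(1)]; code_simp)+
  have small: "filling1 (i, j) \<le> 15" "filling2 (i, j) \<le> 15" if "(i, j) \<in> cells la" "j < 4" for i j
    unfolding filling1_def filling2_def
    by (rule filling_le_15[OF _ _ _ _ that[unfolded la_def]]; code_simp)+
  \<comment> \<open>The two homomorphisms are compared through their values at the identity, on two polytabloids.\<close>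
  have at_id: "F w (polytabloid la t) id = of_int (alternating_weight w t)"
    if "w 0 0 = 1" "tableau la t" "\<And>i j. (i, j) \<in> cells la \<Longrightarrow> j < 4 \<Longrightarrow> t (i, j) \<le> 15" for w t
  proof -
    have "F w (polytabloid la t) id = of_int (\<Sum>p\<in>column_stabilizer la t.
        sign p * block_weight 3 n w (perm_tabloid p (tabloid la t)))"
      unfolding F_def frobenius_map_polytabloid[OF that(2)] by simp
    also have "\<dots> = of_int (alternating_weight w t)"
      using signed_sum_block_weight[OF assms(1), where w = w and r = "3 * n - 6" and t = t] that assms(1)
      unfolding la_def by simp
    finally show ?thesis .
  qed
  have w: "weight1 0 0 = 1" "weight2 0 0 = 1" by (simp_all add: weight1_def weight2_def)
  let ?e1 = "polytabloid la filling1" and ?e2 = "polytabloid la filling2"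
  have at_id_values: "F weight1 ?e1 id = -2" "F weight1 ?e2 id = 0" "F weight2 ?e2 id = 12"
    using at_id[where w = weight1 and t = filling1, OF w(1) t(1) small(1)]
      at_id[where w = weight1 and t = filling2, OF w(1) t(2) small(2)]
      at_id[where w = weight2 and t = filling2, OF w(2) t(2) small(2)]
      alternating_weight_values
    by simp_all
  have e: "?e1 \<in> rep_space (specht la)" "?e2 \<in> rep_space (specht la)"
    using t polytabloid_in_specht by auto
  have irr: "irreducible_rep G (specht la)" unfolding G by (rule irreducible_specht[OF sorted])
  have rS: "representation G (specht la)" using irr by (simp add: irreducible_rep_def)
  define Ws where "Ws = (SOME Ws. irreducible_decomposition G V Ws)"
  have Ws: "irreducible_decomposition G V Ws"
    unfolding Ws_def using V.irreducible_decomposition_exists by (rule someI_ex)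
  let ?L = "filter (\<lambda>W. isomorphic_reps G (specht la) (V\<lparr>rep_space := W\<rparr>)) Ws"
  have "2 \<le> length ?L"
  proof (rule two_homs_imp_multiplicity_ge_2[OF V.rep Ws irr _ hom hom])
    show "\<exists>c. \<forall>v\<in>rep_space (specht la). f v = rep_scale (specht la) c v"
      if "rep_hom G (specht la) (specht la) f" for f
      using specht_endomorphism_scalar[OF sorted] that unfolding G by blast
    show "\<exists>v\<in>rep_space (specht la). F weight1 v \<noteq> 0"
    proof
      show "F weight1 ?e1 \<noteq> 0" using at_id_values(1) by (metis zero_fun_apply neg_equal_0_iff_equal zero_neq_numeral)
    qed (rule e(1))
    show "\<exists>v\<in>rep_space (specht la). F weight2 v \<noteq> rep_scale V c (F weight1 v)" for c
    proof
      have "rep_scale V c (F weight1 ?e2) id = 0" using at_id_values(2) by (simp add: V.scale)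
      then show "F weight2 ?e2 \<noteq> rep_scale V c (F weight1 ?e2)"
        using at_id_values(3) by (metis zero_neq_numeral)
    qed (rule e(2))
  qed
  then have mult: "rep_multiplicity G (specht la) V \<ge> 2" by (simp add: rep_multiplicity_def Ws_def)
  \<comment> \<open>A summand isomorphic to the Specht module is a subrepresentation that violates multiplicity freeness.\<close>
  obtain W where W: "W \<in> set Ws" "isomorphic_reps G (specht la) (V\<lparr>rep_space := W\<rparr>)"
  proof -
    have "?L \<noteq> []" using \<open>2 \<le> length ?L\<close> by auto
    then have "hd ?L \<in> set ?L" by (rule hd_in_set)
    then show thesis using that[of "hd ?L"] by auto
  qed
  have inv: "invariant_subspace G V W" "irreducible_rep G (V\<lparr>rep_space := W\<rparr>)"
    using Ws W(1) by (auto simp: irreducible_decomposition_def)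
  have "rep_multiplicity G (V\<lparr>rep_space := W\<rparr>) V \<ge> 2"
    using mult rep_multiplicity_cong[OF rS _ W(2), of V] inv(2) by (simp add: irreducible_rep_def)
  then have "\<not> multiplicity_free G V" using inv unfolding multiplicity_free_def by fastforce
  then show ?thesis using part mult by blast
qed

end
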